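(* Let $X$ be a metric space with metric $d_X$. Then: (1) The function $d^1_{\mathsf ZX}$ is a well-defined metric on $\mathsf ZX$. (2) $d_{\mathsf KX}(A,B)\le d^1_{\mathsf ZX}(A,B)$ for any $A,B\in\mathsf ZX$. (3) $d^1_{\mathsf ZX}(A,B)=d^1_{\mathsf FX}(A,B)$ for any finite sets $A,B\in\mathsf FX$. (4) $\mathsf FX$ is a dense subset in the metric space $\mathsf Z^1X:=(\mathsf ZX,d^1_{\mathsf ZX})$. (5) If the metric space $X$ is complete, then so is the metric space $\mathsf Z^1X=(\mathsf ZX,d^1_{\mathsf ZX})$. (6) If $Y$ is a dense subspace in $X$, then $d^1_{\mathsf ZY}(A,B)=d^1_{\mathsf ZX}(A,B)$ for any $A,B\in\mathsf ZY$. (7) If $\bar X$ is a completion of the metric space $X$, then $\mathsf Z^1\bar X$ is a completion of the metric space $\mathsf F^1X:=(\mathsf FX,d^1_{\mathsf FX})$.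
   Context: Let $(X,d_X)$ be a metric space. Hyperspaces: $\mathsf KX$ is the set of nonempty compact subsets of $X$ with the Hausdorff metric $d_{\mathsf KX}(A,B)=\max\{\max_{a\in A}\min_{b\in B}d_X(a,b),\max_{b\in B}\min_{a\in A}d_X(b,a)\}$. $\mathsf FX$ is the set of nonempty finite subsets of $X$. $d^1_{\mathsf FX}$ is the largest metric on $\mathsf FX$ such that for every $n\in\mathbb N$ (positive integers) the map $X^n\to\mathsf FX$, $(x_1,\dots,x_n)\mapsto\{x_1,\dots,x_n\}$, is non-expanding (i.e. $1$-Lipschitz) with respect to the $\ell^1$-metric $d^1_{X^n}(x,y)=\sum_{i=1}^n d_X(x_i,y_i)$ on $X^n$ (such a largest metric is known to exist). Graphs: a graph is a pair $\Gamma=(V,E)$ of a (possibly infinite) set $V$ of vertices and a set $E$ of edges, each edge being a nonempty subset of $V$ of cardinality at most $2$. A subset $C\subseteq V$ is connected if any $x,y\in C$ are joined by a sequence $c_0=x,\dots,c_n=y$ in $C$ with $\{c_{i-1},c_i\}\in E$ for $1\le i\le n$; maximal connected subsets of $V$ are the connected components of $\Gamma$. A graph in $X$ is a graph with $V\subseteq X$; its total length is $\ell(\Gamma)=\sum_{\{x,y\}\in E}d_X(x,y)\in[0,\infty]$ (supremum of finite subsums if $E$ is infinite). $\overline C$ denotes the closure in $X$ of $C\subseteq X$. Zero length: for $A\subseteq X$, $\mathbf\Gamma_X(A)$ is the family of graphs $\Gamma=(V,E)$ in $X$ with finitely many connected components such that $A\subseteq\overline V$. The set $A$ has zero length in $X$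 if for every $\varepsilon>0$ there is $\Gamma\in\mathbf\Gamma_X(A)$ with $\ell(\Gamma)<\varepsilon$. $\mathsf ZX$ is the family of nonempty compact subsets of $X$ that have zero length in $X$ (so $\mathsf FX\subseteq\mathsf ZX\subseteq\mathsf KX$). The distance $d^1_{\mathsf ZX}$: for $A,B\in\mathsf ZX$, $\mathbf\Gamma_X(A,B)$ is the family of graphs $\Gamma=(V,E)$ in $X$ such that (i) $A\cup B\subseteq\overline V$; (ii) $\Gamma$ has finitely many connected components; (iii) every connected component $C$ of $\Gamma$ satisfies $A\cap\overline C\ne\emptyset\ne B\cap\overline C$. Put $d^1_{\mathsf ZX}(A,B):=\inf_{\Gamma\in\mathbf\Gamma_X(A,B)}\ell(\Gamma)$. A completion of a metric space $M$ is any complete metric space containing $M$ as a dense (metric) subspace. For subspaces or superspaces of $X$, the same notation is used with that space (with its own metric) in place of $X$. *)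

theory Defs
  imports "HOL-Analysis.Analysis"
begin

text \<open>
  A metric space is a carrier set together with a distance function, as in the locale
  \<^locale>\<open>Metric_space\<close>. A dense subspace \<open>Y\<close> of \<open>X\<close> therefore carries the same
  distance function \<open>d\<close>.
\<close>

subsection \<open>Dense subsets and completions\<close>

definition dense_subset :: "'a set \<Rightarrow> ('a \<Rightarrow> 'a \<Rightarrow> real) \<Rightarrow> 'a set \<Rightarrow> bool" where
  "dense_subset M d S \<longleftrightarrow> S \<subseteq> M \<and> Metric_space.mtopology M d closure_of S = M"

definition is_completion ::
    "'a set \<Rightarrow> ('a \<Rightarrow> 'a \<Rightarrow> real) \<Rightarrow> 'a set \<Rightarrow> ('a \<Rightarrow> 'a \<Rightarrow> real) \<Rightarrow> bool" where
  "is_completion M d M' d' \<longleftrightarrow>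
     Metric_space M d \<and> Metric_space M' d' \<and> Metric_space.mcomplete M' d' \<and>
     (\<forall>x\<in>M. \<forall>y\<in>M. d' x y = d x y) \<and> dense_subset M' d' M"

subsection \<open>Hyperspaces\<close>

definition KX :: "'a set \<Rightarrow> ('a \<Rightarrow> 'a \<Rightarrow> real) \<Rightarrow> 'a set set" where
  "KX X d = {A. A \<noteq> {} \<and> compactin (Metric_space.mtopology X d) A}"

text \<open>On nonempty compact sets the suprema and infima below are attained.\<close>

definition dKX :: "('a \<Rightarrow> 'a \<Rightarrow> real) \<Rightarrow> 'a set \<Rightarrow> 'a set \<Rightarrow> real" where
  "dKX d A B = max (SUP a\<in>A. INF b\<in>B. d a b) (SUP b\<in>B. INF a\<in>A. d b a)"

definition FX :: "'a set \<Rightarrow> 'a set set" where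
  "FX X = {A. A \<noteq> {} \<and> finite A \<and> A \<subseteq> X}"

text \<open>
  An element of \<open>X\<^sup>n\<close>, \<open>n \<ge> 1\<close>, is a nonempty list over \<open>X\<close>, and the canonical
  map \<open>X\<^sup>n \<rightarrow> FX\<close> is \<^const>\<open>set\<close>.
\<close>

definition l1_nonexpanding ::
    "'a set \<Rightarrow> ('a \<Rightarrow> 'a \<Rightarrow> real) \<Rightarrow> ('a set \<Rightarrow> 'a set \<Rightarrow> real) \<Rightarrow> bool" where
  "l1_nonexpanding X d \<rho> \<longleftrightarrow>
     (\<forall>n\<ge>1. \<forall>x y. length x = n \<and> length y = n \<and> set x \<subseteq> X \<and> set y \<subseteq> X \<longrightarrow>
        \<rho> (set x) (set y) \<le> (\<Sum>i<n. d (x ! i) (y ! i)))"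

definition is_largest_FX_metric ::
    "'a set \<Rightarrow> ('a \<Rightarrow> 'a \<Rightarrow> real) \<Rightarrow> ('a set \<Rightarrow> 'a set \<Rightarrow> real) \<Rightarrow> bool" where
  "is_largest_FX_metric X d \<rho> \<longleftrightarrow>
     Metric_space (FX X) \<rho> \<and> l1_nonexpanding X d \<rho> \<and>
     (\<forall>\<sigma>. Metric_space (FX X) \<sigma> \<and> l1_nonexpanding X d \<sigma> \<longrightarrow>
        (\<forall>A\<in>FX X. \<forall>B\<in>FX X. \<sigma> A B \<le> \<rho> A B))"

text \<open>
  The largest metric is unique only on \<open>FX X\<close>, since its values elsewhere are irrelevant;
  hence the choice operator. Existence is \<open>is_largest_FX_metric_d1FX\<close> below.
\<close>

definition d1FX :: "'a set \<Rightarrow> ('a \<Rightarrow> 'a \<Rightarrow> real) \<Rightarrow> 'a set \<Rightarrow> 'a set \<Rightarrow> real" where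
  "d1FX X d = (SOME \<rho>. is_largest_FX_metric X d \<rho>)"

subsection \<open>Graphs\<close>

type_synonym 'a ugraph = "'a set \<times> 'a set set"

text \<open>Edges may be singletons (loops); infinite sets have cardinality 0 and are excluded explicitly.\<close>

definition graph_in :: "'a set \<Rightarrow> 'a ugraph \<Rightarrow> bool" where
  "graph_in X \<Gamma> \<longleftrightarrow> fst \<Gamma> \<subseteq> X \<and>
     (\<forall>e\<in>snd \<Gamma>. e \<noteq> {} \<and> e \<subseteq> fst \<Gamma> \<and> finite e \<and> card e \<le> 2)"

text \<open>Paths of length zero are allowed, so isolated vertices form connected sets.\<close>

definition graph_connected :: "'a ugraph \<Rightarrow> 'a set \<Rightarrow> bool" where
  "graph_connected \<Gamma> C \<longleftrightarrow> C \<subseteq> fst \<Gamma> \<and>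
     (\<forall>x\<in>C. \<forall>y\<in>C. \<exists>n c. c 0 = x \<and> c n = y \<and> (\<forall>i\<le>n. c i \<in> C) \<and>
        (\<forall>i\<in>{1..n::nat}. {c (i - 1), c i} \<in> snd \<Gamma>))"

definition graph_components :: "'a ugraph \<Rightarrow> 'a set set" where
  "graph_components \<Gamma> =
     {C. graph_connected \<Gamma> C \<and> (\<forall>D. graph_connected \<Gamma> D \<and> C \<subseteq> D \<longrightarrow> D = C)}"

definition edge_length :: "('a \<Rightarrow> 'a \<Rightarrow> real) \<Rightarrow> 'a set \<Rightarrow> real" where
  "edge_length d e = (THE r. \<exists>x y. e = {x, y} \<and> r = d x y)"

definition graph_length :: "('a \<Rightarrow> 'a \<Rightarrow> real) \<Rightarrow> 'a ugraph \<Rightarrow> ennreal" where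
  "graph_length d \<Gamma> =
     (SUP F\<in>{F. finite F \<and> F \<subseteq> snd \<Gamma>}. \<Sum>e\<in>F. ennreal (edge_length d e))"

subsection \<open>Sets of zero length and the distance between them\<close>

definition graphs_covering :: "'a set \<Rightarrow> ('a \<Rightarrow> 'a \<Rightarrow> real) \<Rightarrow> 'a set \<Rightarrow> 'a ugraph set" where
  "graphs_covering X d A =
     {\<Gamma>. graph_in X \<Gamma> \<and> finite (graph_components \<Gamma>) \<and>
          A \<subseteq> Metric_space.mtopology X d closure_of (fst \<Gamma>)}"

definition zero_length :: "'a set \<Rightarrow> ('a \<Rightarrow> 'a \<Rightarrow> real) \<Rightarrow> 'a set \<Rightarrow> bool" where
  "zero_length X d A \<longleftrightarrow>
     (\<forall>\<epsilon>::real. \<epsilon> > 0 \<longrightarrow> (\<exists>\<Gamma>\<in>graphs_covering X d A. graph_length d \<Gamma> < ennreal \<epsilon>))"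

definition ZX :: "'a set \<Rightarrow> ('a \<Rightarrow> 'a \<Rightarrow> real) \<Rightarrow> 'a set set" where
  "ZX X d = {A \<in> KX X d. zero_length X d A}"

definition graphs_linking ::
    "'a set \<Rightarrow> ('a \<Rightarrow> 'a \<Rightarrow> real) \<Rightarrow> 'a set \<Rightarrow> 'a set \<Rightarrow> 'a ugraph set" where
  "graphs_linking X d A B =
     {\<Gamma>. graph_in X \<Gamma> \<and>
          A \<union> B \<subseteq> Metric_space.mtopology X d closure_of (fst \<Gamma>) \<and>
          finite (graph_components \<Gamma>) \<and>
          (\<forall>C\<in>graph_components \<Gamma>.
             A \<inter> (Metric_space.mtopology X d closure_of C) \<noteq> {} \<and>
             B \<inter> (Metric_space.mtopology X d closure_of C) \<noteq> {})}"

definition d1ZX_ennreal ::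
    "'a set \<Rightarrow> ('a \<Rightarrow> 'a \<Rightarrow> real) \<Rightarrow> 'a set \<Rightarrow> 'a set \<Rightarrow> ennreal" where
  "d1ZX_ennreal X d A B = (INF \<Gamma>\<in>graphs_linking X d A B. graph_length d \<Gamma>)"

definition d1ZX :: "'a set \<Rightarrow> ('a \<Rightarrow> 'a \<Rightarrow> real) \<Rightarrow> 'a set \<Rightarrow> 'a set \<Rightarrow> real" where
  "d1ZX X d A B = enn2real (d1ZX_ennreal X d A B)"

subsection \<open>Existence of the largest metric on finite sets\<close>

lemma l1_nonexpanding_bounded:
  assumes "A \<in> FX X" "B \<in> FX X"
  shows "\<exists>K. \<forall>\<rho>. l1_nonexpanding X d \<rho> \<longrightarrow> \<rho> A B \<le> K"
proof -
  obtain xs ys where xs: "set xs = A" and ys: "set ys = B"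
    using assms finite_list unfolding FX_def by (metis (mono_tags, lifting) mem_Collect_eq)
  define zs where "zs = List.product xs ys"
  have "set zs = A \<times> B" using xs ys by (simp add: zs_def)
  then have sets: "set (map fst zs) = A" "set (map snd zs) = B" "zs \<noteq> []"
    using assms by (auto simp: FX_def image_iff)
  have "\<rho> A B \<le> (\<Sum>i<length zs. d (map fst zs ! i) (map snd zs ! i))"
    if "l1_nonexpanding X d \<rho>" for \<rho>
  proof -
    have "length zs \<ge> 1" using sets(3) by (simp add: Suc_le_eq)
    moreover have "A \<subseteq> X" "B \<subseteq> X" using assms by (auto simp: FX_def)
    ultimately have "\<rho> (set (map fst zs)) (set (map snd zs))
        \<le> (\<Sum>i<length zs. d (map fst zs ! i) (map snd zs ! i))"
      using that[unfolded l1_nonexpanding_def, rule_format,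
          of "length zs" "map fst zs" "map snd zs"] sets(1,2) by simp
    then show ?thesis unfolding sets(1,2) .
  qed
  then show ?thesis by blast
qed

lemma l1_nonexpanding_metric_exists:
  assumes "Metric_space X d"
  shows "\<exists>\<rho>. Metric_space (FX X) \<rho> \<and> l1_nonexpanding X d \<rho>"
proof -
  interpret Metric_space X d by fact
  define h where "h A B = (if A \<in> FX X \<and> B \<in> FX X
      then Max ((\<lambda>a. Min (d a ` B)) ` A \<union> (\<lambda>b. Min (d b ` A)) ` B) else 0)" for A B
  have h_le: "h A B \<le> r \<longleftrightarrow> (\<forall>a\<in>A. \<exists>b\<in>B. d a b \<le> r) \<and> (\<forall>b\<in>B. \<exists>a\<in>A. d b a \<le> r)"
    if "A \<in> FX X" "B \<in> FX X" for A B r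
    using that by (auto simp: h_def FX_def Min_le_iff ball_Un)
  have h_nonneg: "0 \<le> h A B" for A B
  proof (cases "A \<in> FX X \<and> B \<in> FX X")
    case True
    then obtain a where "a \<in> A" by (auto simp: FX_def)
    with True h_le[of A B "h A B"] obtain b where "d a b \<le> h A B" by auto
    then show ?thesis using nonneg order_trans by blast
  qed (simp only: h_def if_False order_refl)
  have h_commute: "h A B = h B A" for A B
    by (simp add: h_def Un_commute conj_commute)
  have h_zero: "h A B = 0 \<longleftrightarrow> A = B" if "A \<in> FX X" "B \<in> FX X" for A B
  proof
    assume "h A B = 0"
    then have *: "(\<forall>a\<in>A. \<exists>b\<in>B. d a b \<le> 0) \<and> (\<forall>b\<in>B. \<exists>a\<in>A. d b a \<le> 0)"
      using h_le[OF that, of 0] by simp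
    have **: "a = b" if "a \<in> X" "b \<in> X" "d a b \<le> 0" for a b
      using that nonneg[of a b] zero[of a b] by auto
    have "A \<subseteq> X" "B \<subseteq> X" using that by (auto simp: FX_def)
    with * ** show "A = B" by (metis subsetD subsetI subset_antisym)
  next
    assume "A = B"
    have "A \<subseteq> X" using that by (auto simp: FX_def)
    then have "h A A \<le> 0" using h_le[of A A 0] that(1) by (metis mdist_zero order_refl subsetD)
    then show "h A B = 0" using h_nonneg[of A A] \<open>A = B\<close> by simp
  qed
  have h_half: "\<exists>c\<in>C. d a c \<le> h A B + h B C"
    if F: "A \<in> FX X" "B \<in> FX X" "C \<in> FX X" "a \<in> A" for A B C a
  proof -
    obtain b where b: "b \<in> B" "d a b \<le> h A B"
      using h_le[OF F(1,2), of "h A B"] F(4) by auto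
    obtain c where c: "c \<in> C" "d b c \<le> h B C"
      using h_le[OF F(2,3), of "h B C"] b(1) by auto
    have "a \<in> X" "b \<in> X" "c \<in> X" using F b c by (auto simp: FX_def)
    then have "d a c \<le> d a b + d b c" by (rule triangle)
    with b c show ?thesis by (intro bexI[of _ c]) auto
  qed
  have h_triangle: "h A C \<le> h A B + h B C"
    if "A \<in> FX X" "B \<in> FX X" "C \<in> FX X" for A B C
  proof -
    have "\<forall>a\<in>A. \<exists>c\<in>C. d a c \<le> h A B + h B C" using h_half that by blast
    moreover have "\<forall>c\<in>C. \<exists>a\<in>A. d c a \<le> h A B + h B C"
      using h_half[of C B A] that by (simp add: h_commute add.commute)
    ultimately show ?thesis using h_le[OF that(1,3)] by blast
  qed
  have metric: "Metric_space (FX X) h"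
    by unfold_locales (use h_nonneg h_commute h_zero h_triangle in auto)
  have "h (set x) (set y) \<le> (\<Sum>i<n. d (x ! i) (y ! i))"
    if "n \<ge> 1" "length x = n" "length y = n" "set x \<subseteq> X" "set y \<subseteq> X" for n x y
  proof -
    have F: "set x \<in> FX X" "set y \<in> FX X" using that by (auto simp: FX_def)
    have le: "d (x ! i) (y ! i) \<le> (\<Sum>i<n. d (x ! i) (y ! i))" if "i < n" for i
      by (rule member_le_sum) (use that in auto)
    have "\<exists>b\<in>set y. d a b \<le> (\<Sum>i<n. d (x ! i) (y ! i))" if a: "a \<in> set x" for a
    proof -
      obtain i where "i < n" "a = x ! i" using a \<open>length x = n\<close> by (auto simp: in_set_conv_nth)
      with le[of i] \<open>length y = n\<close> show ?thesis by (intro bexI[of _ "y ! i"]) auto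
    qed
    moreover have "\<exists>a\<in>set x. d b a \<le> (\<Sum>i<n. d (x ! i) (y ! i))" if b: "b \<in> set y" for b
    proof -
      obtain i where "i < n" "b = y ! i" using b \<open>length y = n\<close> by (auto simp: in_set_conv_nth)
      with le[of i] \<open>length x = n\<close> show ?thesis
        by (intro bexI[of _ "x ! i"]) (auto simp: commute[of "y ! i"])
    qed
    ultimately show ?thesis using h_le[OF F] by blast
  qed
  then have "l1_nonexpanding X d h" by (simp add: l1_nonexpanding_def)
  with metric show ?thesis by blast
qed

lemma is_largest_FX_metric_exists:
  assumes "Metric_space X d"
  shows "\<exists>\<rho>. is_largest_FX_metric X d \<rho>"
proof -
  define S where "S = {\<sigma>. Metric_space (FX X) \<sigma> \<and> l1_nonexpanding X d \<sigma>}"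
  define \<rho> where "\<rho> A B = (if A \<in> FX X \<and> B \<in> FX X then SUP \<sigma>\<in>S. \<sigma> A B else 0)" for A B
  have ne: "S \<noteq> {}" using l1_nonexpanding_metric_exists[OF assms] by (auto simp: S_def)
  have bdd: "bdd_above ((\<lambda>\<sigma>. \<sigma> A B) ` S)" if F: "A \<in> FX X" "B \<in> FX X" for A B
  proof -
    obtain K where "\<forall>\<rho>. l1_nonexpanding X d \<rho> \<longrightarrow> \<rho> A B \<le> K"
      using l1_nonexpanding_bounded[OF F] by blast
    then show ?thesis by (auto simp: S_def intro!: bdd_aboveI[of _ K])
  qed
  have upper: "\<sigma> A B \<le> \<rho> A B" if "\<sigma> \<in> S" "A \<in> FX X" "B \<in> FX X" for \<sigma> A B
    using cSUP_upper[OF that(1) bdd[OF that(2,3)]] that by (simp add: \<rho>_def)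
  have least: "\<rho> A B \<le> r" if "A \<in> FX X" "B \<in> FX X" "\<And>\<sigma>. \<sigma> \<in> S \<Longrightarrow> \<sigma> A B \<le> r" for A B r
    using that ne by (simp add: \<rho>_def cSUP_least)
  obtain \<sigma>0 where \<sigma>0: "\<sigma>0 \<in> S" using ne by blast
  have nonneg: "0 \<le> \<rho> A B" for A B
  proof (cases "A \<in> FX X \<and> B \<in> FX X")
    case True
    then have "\<sigma>0 A B \<le> \<rho> A B" using upper[OF \<sigma>0] by blast
    moreover have "0 \<le> \<sigma>0 A B" using \<sigma>0 Metric_space.nonneg by (fastforce simp: S_def)
    ultimately show ?thesis by linarith
  qed (simp only: \<rho>_def if_False order_refl)
  have commute: "\<rho> A B = \<rho> B A" for A B
  proof -
    have "(\<lambda>\<sigma>. \<sigma> A B) ` S = (\<lambda>\<sigma>. \<sigma> B A) ` S"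
      by (rule image_cong) (auto simp: S_def intro: Metric_space.commute)
    then show ?thesis by (simp add: \<rho>_def conj_commute)
  qed
  have zero: "\<rho> A B = 0 \<longleftrightarrow> A = B" if F: "A \<in> FX X" "B \<in> FX X" for A B
  proof
    assume "\<rho> A B = 0"
    then have "\<sigma>0 A B \<le> 0" using upper[OF \<sigma>0 F] by simp
    then have "\<sigma>0 A B = 0" using \<sigma>0 Metric_space.nonneg[of "FX X" \<sigma>0 A B] by (simp add: S_def)
    then show "A = B" using \<sigma>0 F Metric_space.zero[of "FX X" \<sigma>0 A B] by (simp add: S_def)
  next
    assume "A = B"
    have "\<rho> A A \<le> 0"
      by (rule least[OF F(1) F(1)]) (use F(1) in \<open>auto simp: S_def Metric_space.mdist_zero\<close>)
    then show "\<rho> A B = 0" using nonneg[of A A] \<open>A = B\<close> by simp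
  qed
  have triangle: "\<rho> A C \<le> \<rho> A B + \<rho> B C"
    if F: "A \<in> FX X" "B \<in> FX X" "C \<in> FX X" for A B C
  proof (rule least[OF F(1,3)])
    fix \<sigma> assume \<sigma>: "\<sigma> \<in> S"
    then have "\<sigma> A C \<le> \<sigma> A B + \<sigma> B C"
      using F Metric_space.triangle by (fastforce simp: S_def)
    with upper[OF \<sigma> F(1,2)] upper[OF \<sigma> F(2,3)] show "\<sigma> A C \<le> \<rho> A B + \<rho> B C" by linarith
  qed
  have "Metric_space (FX X) \<rho>"
    by unfold_locales (use nonneg commute zero triangle in auto)
  moreover have "l1_nonexpanding X d \<rho>"
    unfolding l1_nonexpanding_def
  proof (intro allI impI)
    fix n x y
    assume n: "(1::nat) \<le> n"
      and xy: "length x = n \<and> length y = n \<and> set x \<subseteq> X \<and> set y \<subseteq> X"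
    have "set x \<in> FX X" "set y \<in> FX X" using n xy by (auto simp: FX_def)
    then show "\<rho> (set x) (set y) \<le> (\<Sum>i<n. d (x ! i) (y ! i))"
      by (rule least) (use n xy in \<open>auto simp: S_def l1_nonexpanding_def\<close>)
  qed
  ultimately have "is_largest_FX_metric X d \<rho>"
    using upper by (auto simp: is_largest_FX_metric_def S_def)
  then show ?thesis by (rule exI[where x = \<rho>])
qed

lemma is_largest_FX_metric_d1FX:
  assumes "Metric_space X d"
  shows "is_largest_FX_metric X d (d1FX X d)"
  using is_largest_FX_metric_exists[OF assms] unfolding d1FX_def by (rule someI_ex)

end

theory Submission
  imports Defs
begin

text \<open>
  Everything rests on reshaping linking graphs at an arbitrarily small additional cost, and on
  the fact that finitely many vertices in one component of a graph, however infinite, lie in a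
  finite tree contained in that component.

  \<^emph>\<open>Metric.\<close> If one graph links \<open>A\<close> to \<open>B\<close> and another one links \<open>B\<close> to \<open>C\<close>, their
  components approach common points of \<open>B\<close>. Finitely many short edges near these points join
  the components (\<open>join_graphs\<close>), which gives the triangle inequality. The same device, with edges of
  any length, gives finiteness. The closure of a component has diameter at most the length of the
  graph, so each point of \<open>A\<close> is near \<open>B\<close>: this is the comparison with the Hausdorff distance
  and shows that different compact sets have positive distance. Zero length of \<open>A\<close> means that \<open>A\<close>
  is linked to itself by short graphs (\<open>zero_length_self_linking\<close>); hence \<open>A\<close> has distance zero
  from itself, and representatives of the components of such a graph form a finite set close
  to \<open>A\<close>, so that finite sets are dense.

  \<^emph>\<open>Finite sets.\<close> For finite \<open>F\<close> and \<open>G\<close> short extra edges make the points of \<open>F\<close> and \<open>G\<close> vertices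
  of the graph (\<open>d1ZX_less_joiningE\<close>). In each component a finite tree contains the points of
  \<open>F\<close> and \<open>G\<close> there. Transport along a tree, removing one leaf after another, bounds every
  non-expanding metric by the length of the tree, with each edge used only once
  (\<open>nonexpanding_le_grown_tree\<close>). As the distance of linking graphs is non-expanding as well, it is
  the largest non-expanding metric on finite sets.

  \<^emph>\<open>Completeness.\<close> A Cauchy sequence may be replaced by finite sets \<open>F n\<close> with summable
  distances, joined consecutively by graphs. The union of the graphs from index \<open>n\<close> on is a short
  graph whose vertices are all connected to the finite set \<open>F n\<close>; the points approached by
  all these unions form the limit (\<open>limit_of_joined_finite_sets\<close>).

  \<^emph>\<open>Dense subspaces.\<close> By density of the finite sets it suffices to treat finite sets, for which
  the finite trees can be moved into the subspace (\<open>d1ZX_dense_finite_le\<close>). The statement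
  about completions combines the previous ones.
\<close>

section \<open>Connected sets of vertices\<close>

definition steps :: "'a set set \<Rightarrow> 'a set \<Rightarrow> ('a \<times> 'a) set" where
  "steps E C = {(x, y). x \<in> C \<and> y \<in> C \<and> {x, y} \<in> E}"

lemma steps_mono: "E \<subseteq> E' \<Longrightarrow> C \<subseteq> C' \<Longrightarrow> steps E C \<subseteq> steps E' C'"
  by (auto simp: steps_def)

lemma sym_rtrancl_steps: "(x, y) \<in> (steps E C)\<^sup>* \<Longrightarrow> (y, x) \<in> (steps E C)\<^sup>*"
proof -
  have "sym (steps E C)"
    by (auto simp: sym_def steps_def insert_commute)
  then show "(x, y) \<in> (steps E C)\<^sup>* \<Longrightarrow> (y, x) \<in> (steps E C)\<^sup>*"
    by (meson sym_rtrancl symD)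
qed

lemma rtrancl_steps_iff_walk:
  assumes "x \<in> C"
  shows "(x, y) \<in> (steps E C)\<^sup>* \<longleftrightarrow>
    (\<exists>n c. c 0 = x \<and> c n = y \<and> (\<forall>i\<le>n. c i \<in> C) \<and> (\<forall>i\<in>{1..n::nat}. {c (i - 1), c i} \<in> E))"
proof
  assume "(x, y) \<in> (steps E C)\<^sup>*"
  then obtain n c where c: "c 0 = x" "c n = y" "\<forall>i<n. (c i, c (Suc i)) \<in> steps E C"
    by (auto simp: rtrancl_power relpow_fun_conv)
  have "c i \<in> C" if "i \<le> n" for i
    using that c assms by (cases i) (auto simp: steps_def)
  moreover have "{c (i - 1), c i} \<in> E" if "i \<in> {1..n}" for i
    using that c(3)[rule_format, of "i - 1"] by (auto simp: steps_def)
  ultimately show "\<exists>n c. c 0 = x \<and> c n = y \<and> (\<forall>i\<le>n. c i \<in> C)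
      \<and> (\<forall>i\<in>{1..n::nat}. {c (i - 1), c i} \<in> E)"
    using c(1,2) by blast
next
  assume "\<exists>n c. c 0 = x \<and> c n = y \<and> (\<forall>i\<le>n. c i \<in> C) \<and> (\<forall>i\<in>{1..n::nat}. {c (i - 1), c i} \<in> E)"
  then obtain n c where c: "c 0 = x" "c n = y" "\<forall>i\<le>n. c i \<in> C"
      "\<forall>i\<in>{1..n::nat}. {c (i - 1), c i} \<in> E"
    by blast
  have "(c i, c (Suc i)) \<in> steps E C" if "i < n" for i
    using that c(3) c(4)[rule_format, of "Suc i"] by (auto simp: steps_def)
  with c(1,2) show "(x, y) \<in> (steps E C)\<^sup>*"
    by (auto simp: rtrancl_power relpow_fun_conv)
qed

text \<open>
  Reachability by a reflexive transitive closure replaces explicit walks, so that concatenating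
  and reversing walks come from the theory of relations.
\<close>

lemma graph_connected_iff:
  "graph_connected \<Gamma> C \<longleftrightarrow>
     C \<subseteq> fst \<Gamma> \<and> (\<forall>x\<in>C. \<forall>y\<in>C. (x, y) \<in> (steps (snd \<Gamma>) C)\<^sup>*)"
  unfolding graph_connected_def by (auto simp: rtrancl_steps_iff_walk)

lemma graph_connectedI_center:
  assumes "C \<subseteq> fst \<Gamma>" "\<And>y. y \<in> C \<Longrightarrow> (x, y) \<in> (steps (snd \<Gamma>) C)\<^sup>*"
  shows "graph_connected \<Gamma> C"
  unfolding graph_connected_iff
proof (intro conjI ballI)
  fix y z assume "y \<in> C" "z \<in> C"
  then have "(y, x) \<in> (steps (snd \<Gamma>) C)\<^sup>*" "(x, z) \<in> (steps (snd \<Gamma>) C)\<^sup>*"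
    using assms(2) sym_rtrancl_steps by fast+
  then show "(y, z) \<in> (steps (snd \<Gamma>) C)\<^sup>*" by (rule rtrancl_trans)
qed (use assms in auto)

lemma graph_connected_mono:
  assumes "graph_connected \<Gamma> C" "C \<subseteq> fst \<Gamma>'" "\<And>e. e \<in> snd \<Gamma> \<Longrightarrow> e \<subseteq> C \<Longrightarrow> e \<in> snd \<Gamma>'"
  shows "graph_connected \<Gamma>' C"
proof -
  have "steps (snd \<Gamma>) C \<subseteq> steps (snd \<Gamma>') C"
    using assms(3) by (auto simp: steps_def)
  with assms(1,2) show ?thesis
    unfolding graph_connected_iff using rtrancl_mono by blast
qed

lemma graph_connected_singleton: "x \<in> fst \<Gamma> \<Longrightarrow> graph_connected \<Gamma> {x}"
  by (simp add: graph_connected_iff)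

lemma graph_connected_edge:
  assumes "x \<in> fst \<Gamma>" "y \<in> fst \<Gamma>" "{x, y} \<in> snd \<Gamma>"
  shows "graph_connected \<Gamma> {x, y}"
proof (rule graph_connectedI_center[of _ _ x])
  show "(x, z) \<in> (steps (snd \<Gamma>) {x, y})\<^sup>*" if "z \<in> {x, y}" for z
  proof (cases "z = x")
    case False
    then have "(x, z) \<in> steps (snd \<Gamma>) {x, y}"
      using that assms by (auto simp: steps_def)
    then show ?thesis by blast
  qed simp
qed (use assms in auto)

lemma graph_connected_Union:
  assumes "\<And>D. D \<in> \<D> \<Longrightarrow> graph_connected \<Gamma> D" "\<And>D. D \<in> \<D> \<Longrightarrow> x \<in> D"
  shows "graph_connected \<Gamma> (\<Union>\<D>)"
proof (rule graph_connectedI_center[of _ _ x])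
  show "\<Union>\<D> \<subseteq> fst \<Gamma>"
    using assms(1) by (auto simp: graph_connected_iff)
  fix y assume "y \<in> \<Union>\<D>"
  then obtain D where D: "D \<in> \<D>" "y \<in> D" by blast
  then have "(x, y) \<in> (steps (snd \<Gamma>) D)\<^sup>*"
    using assms by (auto simp: graph_connected_iff)
  moreover have "steps (snd \<Gamma>) D \<subseteq> steps (snd \<Gamma>) (\<Union>\<D>)"
    using D(1) by (intro steps_mono) auto
  ultimately show "(x, y) \<in> (steps (snd \<Gamma>) (\<Union>\<D>))\<^sup>*"
    using rtrancl_mono by blast
qed

lemma graph_connected_Un:
  assumes "graph_connected \<Gamma> C" "graph_connected \<Gamma> D" "C \<inter> D \<noteq> {}"
  shows "graph_connected \<Gamma> (C \<union> D)"
proof -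
  obtain x where "x \<in> C" "x \<in> D" using assms(3) by blast
  then show ?thesis
    using graph_connected_Union[of "{C, D}" \<Gamma> x] assms(1,2) by auto
qed

lemma graph_connected_Un_edge:
  assumes C: "graph_connected \<Gamma> C" "u \<in> C" and D: "graph_connected \<Gamma> D" "v \<in> D"
    and e: "{u, v} \<in> snd \<Gamma>"
  shows "graph_connected \<Gamma> (C \<union> D)"
proof -
  have "u \<in> fst \<Gamma>" "v \<in> fst \<Gamma>" using C D by (auto simp: graph_connected_iff)
  then have "graph_connected \<Gamma> {u, v}" using e by (rule graph_connected_edge)
  then have "graph_connected \<Gamma> (C \<union> {u, v})"
    using C by (intro graph_connected_Un) auto
  then have "graph_connected \<Gamma> ((C \<union> {u, v}) \<union> D)"
    using D(1) by (rule graph_connected_Un) (use D in auto)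
  also have "(C \<union> {u, v}) \<union> D = C \<union> D" using C D by blast
  finally show ?thesis .
qed

lemma graph_connected_image:
  assumes "graph_connected (V, E) C"
  shows "graph_connected (h ` V, (\<lambda>e. h ` e) ` E) (h ` C)"
proof -
  have "(h x, h y) \<in> (steps ((\<lambda>e. h ` e) ` E) (h ` C))\<^sup>*" if "(x, y) \<in> (steps E C)\<^sup>*" for x y
    using that
  proof (induction rule: rtrancl_induct)
    case (step y z)
    then have "{h y, h z} = h ` {y, z}" "{y, z} \<in> E" "y \<in> C" "z \<in> C"
      by (auto simp: steps_def)
    then have "(h y, h z) \<in> steps ((\<lambda>e. h ` e) ` E) (h ` C)"
      by (auto simp: steps_def simp del: image_insert)
    with step.IH show ?case by (rule rtrancl_into_rtrancl)
  qed simp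
  then show ?thesis
    using assms by (auto simp: graph_connected_iff)
qed

section \<open>Connected components\<close>

definition component_of :: "'a ugraph \<Rightarrow> 'a \<Rightarrow> 'a set" where
  "component_of \<Gamma> x = \<Union>{D. graph_connected \<Gamma> D \<and> x \<in> D}"

lemma graph_connected_component_of: "graph_connected \<Gamma> (component_of \<Gamma> x)"
  unfolding component_of_def by (rule graph_connected_Union[of _ _ x]) auto

lemma subset_component_of: "graph_connected \<Gamma> D \<Longrightarrow> x \<in> D \<Longrightarrow> D \<subseteq> component_of \<Gamma> x"
  by (auto simp: component_of_def)

lemma in_component_of: "x \<in> fst \<Gamma> \<Longrightarrow> x \<in> component_of \<Gamma> x"
  using subset_component_of[OF graph_connected_singleton[of x \<Gamma>], of x] by simp

lemma component_of_in_components: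
  assumes "x \<in> fst \<Gamma>"
  shows "component_of \<Gamma> x \<in> graph_components \<Gamma>"
proof -
  have "D = component_of \<Gamma> x" if D: "graph_connected \<Gamma> D" "component_of \<Gamma> x \<subseteq> D" for D
    using D(2) subset_component_of[OF D(1), of x] in_component_of[OF assms] by auto
  then show ?thesis
    by (simp add: graph_components_def graph_connected_component_of)
qed

lemma graph_components_connected: "C \<in> graph_components \<Gamma> \<Longrightarrow> graph_connected \<Gamma> C"
  by (simp add: graph_components_def)

lemma graph_components_subset: "C \<in> graph_components \<Gamma> \<Longrightarrow> C \<subseteq> fst \<Gamma>"
  using graph_components_connected[of C \<Gamma>] by (simp add: graph_connected_iff)

lemma graph_components_absorb:
  assumes "C \<in> graph_components \<Gamma>" "graph_connected \<Gamma> D" "C \<inter> D \<noteq> {}"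
  shows "D \<subseteq> C"
proof -
  have "graph_connected \<Gamma> (C \<union> D)"
    using graph_connected_Un[OF graph_components_connected[OF assms(1)] assms(2,3)] .
  then have "C \<union> D = C" using assms(1) by (simp add: graph_components_def)
  then show ?thesis by blast
qed

lemma graph_components_disjoint:
  assumes "C \<in> graph_components \<Gamma>" "D \<in> graph_components \<Gamma>" "C \<inter> D \<noteq> {}"
  shows "C = D"
  using assms graph_components_absorb[of C \<Gamma> D] graph_components_absorb[of D \<Gamma> C]
    graph_components_connected[of C \<Gamma>] graph_components_connected[of D \<Gamma>] by blast

lemma graph_components_nonempty:
  assumes "fst \<Gamma> \<noteq> {}" "C \<in> graph_components \<Gamma>"
  shows "C \<noteq> {}"
proof
  assume "C = {}"
  obtain x where "x \<in> fst \<Gamma>" using assms(1) by blast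
  then have "graph_connected \<Gamma> {x}" by (rule graph_connected_singleton)
  with assms(2) \<open>C = {}\<close> show False by (auto simp: graph_components_def)
qed

text \<open>
  Constructing a graph together with its exact components is awkward, whereas a finite family of
  connected sets that exhausts the vertices is easily carried along, its members possibly
  overlapping. Every component then contains a member of the family, so a component inherits
  whatever points its member is known to contain or to approach.
\<close>

definition spanned_by :: "'a ugraph \<Rightarrow> 'a set set \<Rightarrow> bool" where
  "spanned_by \<Gamma> \<C> \<longleftrightarrow>
     finite \<C> \<and> (\<forall>C\<in>\<C>. C \<noteq> {} \<and> graph_connected \<Gamma> C) \<and> \<Union>\<C> = fst \<Gamma>"

lemma spanned_by_components:
  assumes "finite (graph_components \<Gamma>)" "fst \<Gamma> \<noteq> {}"
  shows "spanned_by \<Gamma> (graph_components \<Gamma>)"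
proof -
  have "fst \<Gamma> \<subseteq> \<Union>(graph_components \<Gamma>)"
    using component_of_in_components in_component_of by (metis UnionI subsetI)
  moreover have "\<Union>(graph_components \<Gamma>) \<subseteq> fst \<Gamma>"
    using graph_components_subset by (rule Sup_least)
  ultimately show ?thesis
    using assms graph_components_nonempty[OF assms(2)] graph_components_connected[of _ \<Gamma>]
    by (auto simp: spanned_by_def)
qed

lemma spanned_by_component_contains:
  assumes "spanned_by \<Gamma> \<C>" "fst \<Gamma> \<noteq> {}" "K \<in> graph_components \<Gamma>"
  shows "\<exists>C\<in>\<C>. C \<noteq> {} \<and> C \<subseteq> K"
proof -
  obtain x where x: "x \<in> K" "x \<in> fst \<Gamma>"
    using graph_components_nonempty[OF assms(2,3)] graph_components_subset[OF assms(3)] by blast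
  then obtain C where "C \<in> \<C>" "x \<in> C" using assms(1) by (auto simp: spanned_by_def)
  moreover from this have "graph_connected \<Gamma> C" using assms(1) by (auto simp: spanned_by_def)
  ultimately show ?thesis
    using graph_components_absorb[OF assms(3)] x by blast
qed

lemma spanned_by_finite_components:
  assumes "spanned_by \<Gamma> \<C>" "fst \<Gamma> \<noteq> {}"
  shows "finite (graph_components \<Gamma>)"
proof -
  define f where "f K = (SOME C. C \<in> \<C> \<and> C \<noteq> {} \<and> C \<subseteq> K)" for K
  have f: "f K \<in> \<C> \<and> f K \<noteq> {} \<and> f K \<subseteq> K" if "K \<in> graph_components \<Gamma>" for K
    unfolding f_def by (rule someI_ex) (use spanned_by_component_contains[OF assms that] in blast)
  have "inj_on f (graph_components \<Gamma>)"
  proof (rule inj_onI)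
    fix K L assume *: "K \<in> graph_components \<Gamma>" "L \<in> graph_components \<Gamma>" "f K = f L"
    then have "K \<inter> L \<noteq> {}" using f[of K] f[of L] by auto
    with *(1,2) show "K = L" by (rule graph_components_disjoint)
  qed
  moreover have "f ` graph_components \<Gamma> \<subseteq> \<C>" using f by blast
  moreover have "finite \<C>" using assms(1) by (simp add: spanned_by_def)
  ultimately show ?thesis by (rule inj_on_finite)
qed

section \<open>Trees grown leaf by leaf\<close>

text \<open>
  Building trees by adding leaves turns leaf removal into induction.
\<close>

inductive grown_tree :: "'a set \<Rightarrow> 'a set set \<Rightarrow> bool" where
  root: "grown_tree {x} {}"
| leaf: "grown_tree V T \<Longrightarrow> u \<in> V \<Longrightarrow> v \<notin> V \<Longrightarrow> grown_tree (insert v V) (insert {u, v} T)"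

lemma grown_tree_basic:
  assumes "grown_tree V T"
  shows "finite V" "V \<noteq> {}" "finite T" "T \<subseteq> Pow V"
  using assms by (induction, auto)

lemma grown_tree_connected: "grown_tree V T \<Longrightarrow> graph_connected (V, T) V"
proof (induction rule: grown_tree.induct)
  case (root x)
  then show ?case by (simp add: graph_connected_singleton)
next
  case (leaf V T u v)
  have "graph_connected (insert v V, insert {u, v} T) V"
    by (rule graph_connected_mono[OF leaf.IH]) auto
  then have "graph_connected (insert v V, insert {u, v} T) (V \<union> {v})"
    using leaf.hyps by (intro graph_connected_Un_edge[of _ V u "{v}" v] graph_connected_singleton) auto
  then show ?case by simp
qed

text \<open>
  Following a walk, only the vertices that are not yet in the tree are added, each as a leaf. No
  edge is used twice, even if the walk repeats edges.
\<close>

lemma grown_tree_extend: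
  assumes "(x, y) \<in> (steps E C)\<^sup>*" "grown_tree V T" "V \<subseteq> C" "T \<subseteq> E" "x \<in> V"
  shows "\<exists>V' T'. grown_tree V' T' \<and> V \<subseteq> V' \<and> V' \<subseteq> C \<and> T' \<subseteq> E \<and> y \<in> V'"
  using assms(1)
proof (induction rule: rtrancl_induct)
  case base
  then show ?case using assms by blast
next
  case (step y z)
  then obtain V' T' where *: "grown_tree V' T'" "V \<subseteq> V'" "V' \<subseteq> C" "T' \<subseteq> E" "y \<in> V'" by blast
  show ?case
  proof (cases "z \<in> V'")
    case False
    then have "grown_tree (insert z V') (insert {y, z} T')" using * by (intro grown_tree.leaf)
    moreover have "{y, z} \<in> E" "z \<in> C" using step.hyps by (auto simp: steps_def)
    ultimately show ?thesis using * by (intro exI[of _ "insert z V'"] exI[of _ "insert {y, z} T'"]) auto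
  qed (use * in blast)
qed

text \<open>
  This is how finite information is extracted from an infinite connected graph: as the tree uses
  distinct edges of the graph, its length is at most that of the graph.
\<close>

lemma grown_tree_through_finite_set:
  assumes "finite F" "F \<noteq> {}" "F \<subseteq> C" "graph_connected \<Gamma> C"
  shows "\<exists>V T. grown_tree V T \<and> F \<subseteq> V \<and> V \<subseteq> C \<and> T \<subseteq> snd \<Gamma>"
  using assms(1-3)
proof (induction rule: finite_ne_induct)
  case (singleton x)
  then show ?case using grown_tree.root[of x] by blast
next
  case (insert x F)
  then obtain V T where *: "grown_tree V T" "F \<subseteq> V" "V \<subseteq> C" "T \<subseteq> snd \<Gamma>" by blast
  obtain u where u: "u \<in> V" using grown_tree_basic(2)[OF *(1)] by blast
  then have "(u, x) \<in> (steps (snd \<Gamma>) C)\<^sup>*"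
    using assms(4) * insert.prems by (auto simp: graph_connected_iff)
  from grown_tree_extend[OF this *(1,3,4) u] *(2) show ?case by blast
qed

section \<open>Length of graphs in a metric space\<close>

lemma graph_length_le_iff:
  "graph_length d \<Gamma> \<le> c \<longleftrightarrow>
     (\<forall>F. finite F \<longrightarrow> F \<subseteq> snd \<Gamma> \<longrightarrow> (\<Sum>e\<in>F. ennreal (edge_length d e)) \<le> c)"
  by (auto simp: graph_length_def SUP_le_iff)

lemma sum_le_graph_length:
  "finite F \<Longrightarrow> F \<subseteq> snd \<Gamma> \<Longrightarrow> (\<Sum>e\<in>F. ennreal (edge_length d e)) \<le> graph_length d \<Gamma>"
  using graph_length_le_iff by blast

lemma graph_length_mono: "snd \<Gamma> \<subseteq> snd \<Delta> \<Longrightarrow> graph_length d \<Gamma> \<le> graph_length d \<Delta>"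
  by (meson graph_length_le_iff sum_le_graph_length subset_trans)

lemma graph_length_Un:
  assumes "snd \<Lambda> = snd \<Gamma> \<union> snd \<Delta>"
  shows "graph_length d \<Lambda> \<le> graph_length d \<Gamma> + graph_length d \<Delta>"
  unfolding graph_length_le_iff
proof (intro allI impI)
  let ?l = "\<lambda>F. \<Sum>e\<in>F. ennreal (edge_length d e)"
  fix F assume F: "finite F" "F \<subseteq> snd \<Lambda>"
  have "?l F = ?l (F \<inter> snd \<Gamma>) + ?l (F - snd \<Gamma>)"
    using F(1) by (subst sum.union_disjoint[symmetric]) (auto intro: arg_cong2[where f = sum])
  also have "\<dots> \<le> graph_length d \<Gamma> + graph_length d \<Delta>"
    using F assms by (intro add_mono sum_le_graph_length) auto
  finally show "?l F \<le> graph_length d \<Gamma> + graph_length d \<Delta>" .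
qed

lemma graph_length_no_edges: "graph_length d (V, {}) = 0"
proof -
  have "graph_length d (V, {}) \<le> 0" unfolding graph_length_le_iff by simp
  then show ?thesis by simp
qed

context Metric_space
begin

abbreviation cl :: "'a set \<Rightarrow> 'a set" where
  "cl S \<equiv> mtopology closure_of S"

lemma in_cl_iff: "x \<in> cl S \<longleftrightarrow> x \<in> M \<and> (\<forall>r>0. \<exists>y\<in>S. y \<in> M \<and> d x y < r)"
  by (fastforce simp: metric_closure_of)

lemma subset_cl: "S \<subseteq> M \<Longrightarrow> S \<subseteq> cl S"
  by (simp add: closure_of_subset)

lemma cl_mono: "S \<subseteq> T \<Longrightarrow> cl S \<subseteq> cl T"
  by (rule closure_of_mono)

lemma edge_length_pair: "edge_length d {x, y} = d x y"
  unfolding edge_length_def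
  by (rule the_equality) (auto simp: doubleton_eq_iff commute)

lemma graph_in_iff:
  fixes S :: "'a set"
  shows "graph_in S \<Gamma> \<longleftrightarrow> fst \<Gamma> \<subseteq> S \<and> (\<forall>e\<in>snd \<Gamma>. \<exists>x\<in>fst \<Gamma>. \<exists>y\<in>fst \<Gamma>. e = {x, y})"
proof -
  have *: "e \<noteq> {} \<and> e \<subseteq> V \<and> finite e \<and> card e \<le> 2 \<longleftrightarrow> (\<exists>x\<in>V. \<exists>y\<in>V. e = {x, y})" for e V :: "'a set"
  proof
    assume e: "e \<noteq> {} \<and> e \<subseteq> V \<and> finite e \<and> card e \<le> 2"
    then have "card e = 1 \<or> card e = 2"
      using card_gt_0_iff[of e] by linarith
    then obtain x y where "e = {x, y}"
      by (metis card_1_singletonE card_2_iff insert_absorb2)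
    with e show "\<exists>x\<in>V. \<exists>y\<in>V. e = {x, y}" by auto
  qed (auto simp: card_insert_if)
  show ?thesis unfolding graph_in_def * by (rule refl)
qed

lemma edge_length_nonneg: "graph_in S \<Gamma> \<Longrightarrow> e \<in> snd \<Gamma> \<Longrightarrow> 0 \<le> edge_length d e"
  by (auto simp: graph_in_iff edge_length_pair)

lemma sum_edge_length_le:
  assumes "graph_in S \<Gamma>" "graph_length d \<Gamma> \<le> ennreal r" "0 \<le> r" "finite F" "F \<subseteq> snd \<Gamma>"
  shows "(\<Sum>e\<in>F. edge_length d e) \<le> r"
proof -
  have "ennreal (\<Sum>e\<in>F. edge_length d e) = (\<Sum>e\<in>F. ennreal (edge_length d e))"
    using assms edge_length_nonneg by (intro sum_ennreal[symmetric]) blast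
  also have "\<dots> \<le> ennreal r"
    using assms sum_le_graph_length order_trans by blast
  finally show ?thesis using assms(3) by simp
qed

lemma graph_length_added_edges:
  assumes "finite I"
  shows "graph_length d (V, (\<lambda>i. {u i, v i}) ` I) \<le> ennreal (\<Sum>i\<in>I. d (u i) (v i))"
  unfolding graph_length_le_iff
proof (intro allI impI)
  let ?E = "(\<lambda>i. {u i, v i}) ` I"
  fix F assume F: "finite F" "F \<subseteq> snd (V, ?E)"
  have "(\<Sum>e\<in>F. ennreal (edge_length d e)) \<le> (\<Sum>e\<in>?E. ennreal (edge_length d e))"
    using F assms by (intro sum_mono2) auto
  also have "\<dots> \<le> (\<Sum>i\<in>I. ennreal (edge_length d {u i, v i}))"
    using sum_image_le[OF assms, of "\<lambda>e. ennreal (edge_length d e)" "\<lambda>i. {u i, v i}"]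
    by (simp add: o_def)
  also have "\<dots> = ennreal (\<Sum>i\<in>I. d (u i) (v i))"
    by (simp add: edge_length_pair sum_ennreal)
  finally show "(\<Sum>e\<in>F. ennreal (edge_length d e)) \<le> ennreal (\<Sum>i\<in>I. d (u i) (v i))" .
qed

text \<open>
  The new edge is distinct from all old ones since the leaf is a new vertex.
\<close>

lemma sum_edges_new_leaf:
  assumes "grown_tree V T" "v \<notin> V"
  shows "(\<Sum>e\<in>insert {u, v} T. edge_length d e) = d u v + (\<Sum>e\<in>T. edge_length d e)"
proof -
  have "{u, v} \<notin> T" using grown_tree_basic(4)[OF assms(1)] assms(2) by blast
  then show ?thesis using grown_tree_basic(3)[OF assms(1)] by (simp add: edge_length_pair)
qed

lemma grown_tree_distance_le:
  assumes "grown_tree V T" "V \<subseteq> M" "x \<in> V" "y \<in> V"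
  shows "d x y \<le> (\<Sum>e\<in>T. edge_length d e)"
  using assms
proof (induction arbitrary: x y rule: grown_tree.induct)
  case (leaf V T u v)
  have pos: "0 \<le> (\<Sum>e\<in>T. edge_length d e)"
    using leaf.IH[of u u] leaf.hyps leaf.prems by auto
  have *: "d v z \<le> d u v + (\<Sum>e\<in>T. edge_length d e)" if "z \<in> V" for z
  proof -
    have "d v z \<le> d v u + d u z" using leaf that by (intro triangle) auto
    moreover have "d u z \<le> (\<Sum>e\<in>T. edge_length d e)" using leaf that by auto
    ultimately show ?thesis by (simp add: commute)
  qed
  have "d x y \<le> d u v + (\<Sum>e\<in>T. edge_length d e)"
  proof -
    consider "x = v" "y = v" | "x = v" "y \<in> V" | "x \<in> V" "y = v" | "x \<in> V" "y \<in> V"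
      using leaf.prems by blast
    then show ?thesis
    proof cases
      case 1
      then show ?thesis using pos leaf.prems by (simp add: add_nonneg_nonneg)
    next
      case 2
      then show ?thesis using * by simp
    next
      case 3
      then show ?thesis using *[of x] by (simp add: commute)
    next
      case 4
      then have "d x y \<le> (\<Sum>e\<in>T. edge_length d e)" using leaf by auto
      then show ?thesis using nonneg[of u v] by linarith
    qed
  qed
  then show ?case using sum_edges_new_leaf[OF leaf.hyps(1,3)] by simp
qed (auto simp: mdist_zero)

text \<open>
  A walk in the graph could repeat edges and be longer than the graph; a tree containing both
  points cannot.
\<close>

lemma graph_connected_distance_le:
  assumes "graph_in M \<Gamma>" "graph_length d \<Gamma> \<le> ennreal r" "0 \<le> r"
    and "graph_connected \<Gamma> C" "x \<in> C" "y \<in> C"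
  shows "d x y \<le> r"
proof -
  obtain V T where T: "grown_tree V T" "{x, y} \<subseteq> V" "V \<subseteq> C" "T \<subseteq> snd \<Gamma>"
    using grown_tree_through_finite_set[of "{x, y}" C \<Gamma>] assms by auto
  have "V \<subseteq> M" using T(3) assms(1,4) by (auto simp: graph_connected_iff graph_in_iff)
  then have "d x y \<le> (\<Sum>e\<in>T. edge_length d e)"
    using T by (intro grown_tree_distance_le) auto
  also have "\<dots> \<le> r"
    using T assms grown_tree_basic(3) by (intro sum_edge_length_le) auto
  finally show ?thesis .
qed

lemma graph_connected_distance_cl_le:
  assumes "graph_in M \<Gamma>" "graph_length d \<Gamma> \<le> ennreal r" "0 \<le> r"
    and "graph_connected \<Gamma> C" "x \<in> cl C" "y \<in> cl C"
  shows "d x y \<le> r"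
proof (rule field_le_epsilon)
  fix e :: real assume "e > 0"
  then obtain x' y' where x': "x' \<in> C" "x' \<in> M" "d x x' < e/2" and y': "y' \<in> C" "y' \<in> M" "d y y' < e/2"
    using assms(5,6) by (meson in_cl_iff half_gt_zero)
  have "x \<in> M" "y \<in> M" using assms(5,6) by (auto simp: in_cl_iff)
  then have "d x y \<le> d x x' + d x' y" "d x' y \<le> d x' y' + d y' y"
    using x' y' by (auto intro: triangle)
  moreover have "d x' y' \<le> r" using assms x' y' graph_connected_distance_le by blast
  ultimately show "d x y \<le> r + e" using x' y' by (simp add: commute)
qed

section \<open>Non-expanding metrics along trees\<close>

lemma l1_nonexpanding_insert:
  assumes "l1_nonexpanding M d \<sigma>" "finite W" "W \<subseteq> M" "u \<in> M" "v \<in> M"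
  shows "\<sigma> (insert u W) (insert v W) \<le> d u v"
proof -
  obtain ws where ws: "set ws = W" using assms(2) finite_list by blast
  have "\<sigma> (set (u # ws)) (set (v # ws)) \<le> (\<Sum>i<length (u # ws). d ((u # ws) ! i) ((v # ws) ! i))"
    using assms ws
    by (intro assms(1)[unfolded l1_nonexpanding_def, rule_format]) auto
  also have "\<dots> = d u v + (\<Sum>i<length ws. d (ws ! i) (ws ! i))"
    by (simp only: length_Cons sum.lessThan_Suc_shift) simp
  also have "(\<Sum>i<length ws. d (ws ! i) (ws ! i)) = 0"
    using ws assms(3) by (intro sum.neutral) (auto intro!: mdist_zero)
  finally show ?thesis using ws by simp
qed

text \<open>
  A tree transports \<open>A\<close> to \<open>B\<close> using every edge once. Removing the leaf \<open>v\<close> at \<open>u\<close>, the points of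
  \<open>A\<close> and of \<open>B\<close> at \<open>v\<close> are first moved to \<open>u\<close>. If both sets contain \<open>v\<close>, doing so would pay for
  the edge twice; instead \<open>v\<close> becomes a stationary point. The stationary points are collected
  in \<open>W\<close>, which has to be carried through the induction because for an arbitrary
  non-expanding metric adding common points to both sets may increase their distance.
\<close>

lemma nonexpanding_le_grown_tree:
  assumes \<sigma>: "Metric_space (FX M) \<sigma>" "l1_nonexpanding M d \<sigma>"
  assumes "grown_tree V T" "V \<subseteq> M" "A \<subseteq> V" "B \<subseteq> V" "A \<noteq> {}" "B \<noteq> {}" "finite W" "W \<subseteq> M"
  shows "\<sigma> (A \<union> W) (B \<union> W) \<le> (\<Sum>e\<in>T. edge_length d e)"
  using assms(3-)
proof (induction arbitrary: A B W rule: grown_tree.induct)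
  case (root x)
  then have "A = B" "A \<union> W \<in> FX M" by (auto simp: FX_def intro: finite_subset)
  then show ?case using Metric_space.mdist_zero[OF \<sigma>(1)] by simp
next
  case (leaf V T u v)
  let ?t = "\<Sum>e\<in>T. edge_length d e"
  have uv: "u \<in> M" "v \<in> M" "u \<noteq> v" "finite V" "V \<subseteq> M"
    using leaf.hyps leaf.prems grown_tree_basic(1)[OF leaf.hyps(1)] by auto
  have \<sigma>tri: "\<sigma> P R \<le> p + q" if "\<sigma> P Q \<le> p" "\<sigma> Q R \<le> q" "P \<in> FX M" "Q \<in> FX M" "R \<in> FX M" for P Q R p q
    using that Metric_space.triangle[OF \<sigma>(1), of P Q R] by linarith
  have FX: "P \<union> W \<in> FX M" if "P \<subseteq> insert v V" "P \<noteq> {}" for P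
    using that leaf.prems(6,7) uv by (auto simp: FX_def intro: finite_subset)
  have FX1: "insert w P \<in> FX M" if "P \<union> W \<in> FX M" "w \<in> M" for w P
    using that by (auto simp: FX_def)
  have move: "\<sigma> (P \<union> W) (insert u (P - {v}) \<union> W) \<le> d u v" if "P \<subseteq> insert v V" "v \<in> P" for P
  proof -
    have "\<sigma> (insert v (P - {v} \<union> W)) (insert u (P - {v} \<union> W)) \<le> d v u"
      using that leaf.prems(6,7) uv
      by (intro l1_nonexpanding_insert[OF \<sigma>(2)]) (auto intro: finite_subset)
    moreover have "insert v (P - {v} \<union> W) = P \<union> W" using that by blast
    ultimately show ?thesis by (simp add: commute)
  qed
  \<comment> \<open>if one set is just \<open>{v}\<close>, then \<open>v\<close> stays and a copy of it travels along the edge\<close>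
  have split: "\<sigma> ({v} \<union> W) (P \<union> W) \<le> d u v + ?t" if P: "P \<subseteq> insert v V" "v \<in> P" "P \<noteq> {v}" for P
  proof (rule \<sigma>tri)
    show "\<sigma> ({v} \<union> W) (insert u (insert v W)) \<le> d u v"
      using l1_nonexpanding_insert[OF \<sigma>(2), of "insert v W" v u] leaf.prems(6,7) uv
      by (simp add: commute)
    have "\<sigma> ({u} \<union> insert v W) ((P - {v}) \<union> insert v W) \<le> ?t"
      using P leaf.hyps leaf.prems(6,7) uv by (intro leaf.IH) auto
    moreover have "(P - {v}) \<union> insert v W = P \<union> W" using P by blast
    ultimately show "\<sigma> (insert u (insert v W)) (P \<union> W) \<le> ?t" by (simp only: Un_insert_left Un_empty_left)
    show "insert u (insert v W) \<in> FX M" "{v} \<union> W \<in> FX M" "P \<union> W \<in> FX M"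
      using P FX uv leaf.prems(6,7) by (auto simp: FX_def)
  qed
  have pos: "0 \<le> ?t"
    using grown_tree_distance_le[OF leaf.hyps(1) uv(5) leaf.hyps(2) leaf.hyps(2)] uv(1) by simp
  have "\<sigma> (A \<union> W) (B \<union> W) \<le> d u v + ?t"
  proof -
    consider "v \<notin> A" "v \<notin> B" | "v \<in> A" "v \<notin> B" | "v \<notin> A" "v \<in> B"
      | "v \<in> A" "v \<in> B" "A = {v}" | "v \<in> A" "v \<in> B" "B = {v}"
      | "v \<in> A" "v \<in> B" "A \<noteq> {v}" "B \<noteq> {v}" by blast
    then show ?thesis
    proof cases
      case 1
      then have "\<sigma> (A \<union> W) (B \<union> W) \<le> ?t" using leaf.prems uv by (intro leaf.IH) auto
      then show ?thesis using nonneg[of u v] by linarith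
    next
      case 2
      show ?thesis
      proof (rule \<sigma>tri)
        show "\<sigma> (A \<union> W) (insert u (A - {v}) \<union> W) \<le> d u v" using 2 leaf.prems by (intro move)
        show "\<sigma> (insert u (A - {v}) \<union> W) (B \<union> W) \<le> ?t"
          using 2 leaf.prems leaf.hyps uv by (intro leaf.IH) auto
      qed (intro FX; use leaf.prems leaf.hyps in auto)+
    next
      case 3
      have "\<sigma> (A \<union> W) (B \<union> W) \<le> ?t + d u v"
      proof (rule \<sigma>tri)
        show "\<sigma> (insert u (B - {v}) \<union> W) (B \<union> W) \<le> d u v"
          using 3 leaf.prems move[of B] Metric_space.commute[OF \<sigma>(1)] by simp
        show "\<sigma> (A \<union> W) (insert u (B - {v}) \<union> W) \<le> ?t"
          using 3 leaf.prems leaf.hyps uv by (intro leaf.IH) auto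
      qed (intro FX; use leaf.prems leaf.hyps in auto)+
      then show ?thesis by simp
    next
      case 4
      show ?thesis
      proof (cases "B = {v}")
        case True
        then have "\<sigma> (A \<union> W) (B \<union> W) = 0"
          using 4 FX[of A] leaf.prems Metric_space.mdist_zero[OF \<sigma>(1)] by simp
        then show ?thesis using pos nonneg[of u v] by linarith
      qed (use 4 split[of B] leaf.prems in auto)
    next
      case 5
      show ?thesis
      proof (cases "A = {v}")
        case True
        then have "\<sigma> (A \<union> W) (B \<union> W) = 0"
          using 5 FX[of A] leaf.prems Metric_space.mdist_zero[OF \<sigma>(1)] by simp
        then show ?thesis using pos nonneg[of u v] by linarith
      qed (use 5 split[of A] leaf.prems Metric_space.commute[OF \<sigma>(1)] in auto)
    next
      case 6
      have "\<sigma> ((A - {v}) \<union> insert v W) ((B - {v}) \<union> insert v W) \<le> ?t"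
        using 6 leaf.prems leaf.hyps uv by (intro leaf.IH) auto
      moreover have "(A - {v}) \<union> insert v W = A \<union> W" "(B - {v}) \<union> insert v W = B \<union> W"
        using 6 by blast+
      ultimately have "\<sigma> (A \<union> W) (B \<union> W) \<le> ?t" by simp
      then show ?thesis using nonneg[of u v] by linarith
    qed
  qed
  then show ?case using sum_edges_new_leaf[OF leaf.hyps(1,3)] by simp
qed

section \<open>Linking graphs\<close>

lemma spanned_by_cl:
  assumes "spanned_by \<Gamma> \<C>" "x \<in> cl (fst \<Gamma>)"
  shows "\<exists>C\<in>\<C>. x \<in> cl C"
proof -
  have "cl (\<Union>\<C>) = (\<Union>C\<in>\<C>. cl C)"
    using assms(1) by (intro closure_of_Union) (simp add: spanned_by_def)
  then show ?thesis using assms by (auto simp: spanned_by_def)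
qed

lemma graphs_linkingI:
  assumes "graph_in M \<Gamma>" and span: "spanned_by \<Gamma> \<C>" and "A \<noteq> {}" and AB: "A \<union> B \<subseteq> cl (fst \<Gamma>)"
    and touch: "\<And>C. C \<in> \<C> \<Longrightarrow> A \<inter> cl C \<noteq> {} \<and> B \<inter> cl C \<noteq> {}"
  shows "\<Gamma> \<in> graphs_linking M d A B"
proof -
  have "fst \<Gamma> \<noteq> {}" using assms(3) AB by auto
  note ne = span this
  have "A \<inter> cl K \<noteq> {} \<and> B \<inter> cl K \<noteq> {}" if K: "K \<in> graph_components \<Gamma>" for K
  proof -
    obtain C where "C \<in> \<C>" "C \<subseteq> K" using spanned_by_component_contains[OF ne K] by blast
    then show ?thesis using touch cl_mono[of C K] by blast
  qed
  then show ?thesis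
    using assms spanned_by_finite_components[OF ne] by (simp add: graphs_linking_def)
qed

lemma graphs_linkingD:
  assumes "\<Gamma> \<in> graphs_linking M d A B" "A \<noteq> {}"
  shows "graph_in M \<Gamma>" "spanned_by \<Gamma> (graph_components \<Gamma>)" "A \<union> B \<subseteq> cl (fst \<Gamma>)"
    "\<And>C. C \<in> graph_components \<Gamma> \<Longrightarrow> A \<inter> cl C \<noteq> {} \<and> B \<inter> cl C \<noteq> {}"
proof -
  show "graph_in M \<Gamma>" and AB: "A \<union> B \<subseteq> cl (fst \<Gamma>)"
    and "\<And>C. C \<in> graph_components \<Gamma> \<Longrightarrow> A \<inter> cl C \<noteq> {} \<and> B \<inter> cl C \<noteq> {}"
    using assms(1) by (auto simp: graphs_linking_def)
  have "fst \<Gamma> \<noteq> {}" using AB assms(2) by auto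
  then show "spanned_by \<Gamma> (graph_components \<Gamma>)"
    using assms(1) by (intro spanned_by_components) (auto simp: graphs_linking_def)
qed

text \<open>
  The relation \<open>R\<close> says which connected pieces of the two graphs are to be joined by an edge, and
  \<open>w\<close> bounds the costs of the new edges. As each piece on either side occurs in \<open>R\<close>, the joined
  pairs span the union. Finiteness of the distance, the triangle inequality and the
  replacement of closures by vertices for finite sets are three choices of \<open>R\<close>.
\<close>

lemma join_graphs:
  assumes \<Gamma>: "graph_in M \<Gamma>" "spanned_by \<Gamma> \<C>" and \<Delta>: "graph_in M \<Delta>" "spanned_by \<Delta> \<D>"
    and R: "R \<subseteq> \<C> \<times> \<D>" "fst ` R = \<C>" "snd ` R = \<D>"
    and short: "\<And>C D. (C, D) \<in> R \<Longrightarrow> \<exists>u\<in>C. \<exists>v\<in>D. d u v \<le> w (C, D)"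
  shows "\<exists>\<Lambda>. graph_in M \<Lambda> \<and> fst \<Lambda> = fst \<Gamma> \<union> fst \<Delta> \<and>
    spanned_by \<Lambda> ((\<lambda>(C, D). C \<union> D) ` R) \<and>
    graph_length d \<Lambda> \<le> graph_length d \<Gamma> + graph_length d \<Delta> + ennreal (\<Sum>p\<in>R. w p)"
proof -
  have "finite R" using R(1) \<Gamma>(2) \<Delta>(2) by (auto simp: spanned_by_def intro: finite_subset)
  have "\<forall>p\<in>R. \<exists>q. fst q \<in> fst p \<and> snd q \<in> snd p \<and> d (fst q) (snd q) \<le> w p"
    using short by fastforce
  then obtain q where q:
    "\<And>p. p \<in> R \<Longrightarrow> fst (q p) \<in> fst p \<and> snd (q p) \<in> snd p \<and> d (fst (q p)) (snd (q p)) \<le> w p"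
    by metis
  define u v where "u p = fst (q p)" and "v p = snd (q p)" for p
  have uv: "\<And>p. p \<in> R \<Longrightarrow> u p \<in> fst p \<and> v p \<in> snd p \<and> d (u p) (v p) \<le> w p"
    using q by (simp add: u_def v_def)
  define J where "J = (\<lambda>p. {u p, v p}) ` R"
  define \<Lambda> where "\<Lambda> = (fst \<Gamma> \<union> fst \<Delta>, (snd \<Gamma> \<union> snd \<Delta>) \<union> J)"
  have V: "\<Union>\<C> = fst \<Gamma>" "\<Union>\<D> = fst \<Delta>"
    using \<Gamma>(2) \<Delta>(2) by (simp_all add: spanned_by_def)
  have sub: "C \<subseteq> fst \<Gamma>" "D \<subseteq> fst \<Delta>" if "(C, D) \<in> R" for C D
    using that R(1) unfolding V[symmetric] by auto
  have "graph_in M \<Lambda>"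
    unfolding graph_in_iff
  proof (intro conjI ballI)
    show "fst \<Lambda> \<subseteq> M" using \<Gamma>(1) \<Delta>(1) by (simp add: graph_in_iff \<Lambda>_def)
    fix e assume "e \<in> snd \<Lambda>"
    then consider "e \<in> snd \<Gamma>" | "e \<in> snd \<Delta>" | p where "p \<in> R" "e = {u p, v p}"
      by (auto simp: \<Lambda>_def J_def)
    then show "\<exists>x\<in>fst \<Lambda>. \<exists>y\<in>fst \<Lambda>. e = {x, y}"
    proof cases
      case 1
      then show ?thesis using \<Gamma>(1) unfolding graph_in_iff \<Lambda>_def by (metis UnCI fst_conv)
    next
      case 2
      then show ?thesis using \<Delta>(1) unfolding graph_in_iff \<Lambda>_def by (metis UnCI fst_conv)
    next
      case 3
      then have "u p \<in> fst \<Lambda>" "v p \<in> fst \<Lambda>"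
        using sub[of "fst p" "snd p"] uv[of p] by (auto simp: \<Lambda>_def)
      with 3 show ?thesis by blast
    qed
  qed
  moreover have "spanned_by \<Lambda> ((\<lambda>(C, D). C \<union> D) ` R)"
  proof -
    have "C \<union> D \<noteq> {} \<and> graph_connected \<Lambda> (C \<union> D)" if p: "(C, D) \<in> R" for C D
    proof -
      have C: "C \<noteq> {}" "graph_connected \<Gamma> C" and D: "graph_connected \<Delta> D"
        using p R(1) \<Gamma>(2) \<Delta>(2) by (auto simp: spanned_by_def)
      have "graph_connected \<Lambda> C"
        by (rule graph_connected_mono[OF C(2)]) (use sub(1)[OF p] in \<open>auto simp: \<Lambda>_def\<close>)
      moreover have "graph_connected \<Lambda> D"
        by (rule graph_connected_mono[OF D]) (use sub(2)[OF p] in \<open>auto simp: \<Lambda>_def\<close>)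
      moreover have "{u (C, D), v (C, D)} \<in> snd \<Lambda>" using p by (auto simp: \<Lambda>_def J_def)
      ultimately have "graph_connected \<Lambda> (C \<union> D)"
        using uv[OF p] graph_connected_Un_edge[of \<Lambda> C "u (C, D)" D "v (C, D)"] by auto
      with C(1) show ?thesis by blast
    qed
    moreover have "\<Union>((\<lambda>(C, D). C \<union> D) ` R) = \<Union>(fst ` R) \<union> \<Union>(snd ` R)"
      by force
    ultimately show ?thesis
      using \<open>finite R\<close> R(2,3) \<Gamma>(2) \<Delta>(2) by (auto simp: spanned_by_def \<Lambda>_def)
  qed
  moreover have "graph_length d \<Lambda> \<le> graph_length d \<Gamma> + graph_length d \<Delta> + ennreal (\<Sum>p\<in>R. w p)"
  proof -
    have "graph_length d \<Lambda> \<le> graph_length d ({}, snd \<Gamma> \<union> snd \<Delta>) + graph_length d ({}, J)"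
      by (rule graph_length_Un) (simp add: \<Lambda>_def)
    moreover have "graph_length d ({}, snd \<Gamma> \<union> snd \<Delta>) \<le> graph_length d \<Gamma> + graph_length d \<Delta>"
      by (rule graph_length_Un) simp
    moreover have "graph_length d ({}, J) \<le> ennreal (\<Sum>p\<in>R. w p)"
    proof -
      have "graph_length d ({}, J) \<le> ennreal (\<Sum>p\<in>R. d (u p) (v p))"
        unfolding J_def by (rule graph_length_added_edges[OF \<open>finite R\<close>])
      also have "\<dots> \<le> ennreal (\<Sum>p\<in>R. w p)"
        using uv by (intro ennreal_leI sum_mono) auto
      finally show ?thesis .
    qed
    ultimately show ?thesis by (meson add_mono order_trans)
  qed
  ultimately show ?thesis by (auto simp: \<Lambda>_def intro!: exI[of _ \<Lambda>])
qed

section \<open>The metric on sets of zero length\<close>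

lemma ZX_D:
  assumes "A \<in> ZX M d"
  shows "A \<noteq> {}" "A \<subseteq> M" "compactin mtopology A" "zero_length M d A"
  using assms compactin_subset_topspace[of mtopology A] by (auto simp: ZX_def KX_def)

text \<open>
  Discarding the components that stay away from \<open>A\<close> turns a covering graph into one that
  links \<open>A\<close> to itself; as there are only finitely many components, the closure of the remaining
  ones still covers \<open>A\<close>.
\<close>

lemma zero_length_self_linking:
  assumes A: "A \<in> ZX M d" and "e > 0"
  shows "\<exists>\<Gamma>\<in>graphs_linking M d A A. graph_length d \<Gamma> < ennreal e"
proof -
  obtain \<Gamma> where "\<Gamma> \<in> graphs_covering M d A" and len: "graph_length d \<Gamma> < ennreal e"
    using ZX_D(4)[OF A] \<open>e > 0\<close> by (auto simp: zero_length_def)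
  then have \<Gamma>: "graph_in M \<Gamma>" "finite (graph_components \<Gamma>)" "A \<subseteq> cl (fst \<Gamma>)"
    by (auto simp: graphs_covering_def)
  have "fst \<Gamma> \<noteq> {}" using \<Gamma>(3) ZX_D(1)[OF A] by auto
  then have span: "spanned_by \<Gamma> (graph_components \<Gamma>)" using \<Gamma>(2) by (intro spanned_by_components)
  define \<G> where "\<G> = {C \<in> graph_components \<Gamma>. A \<inter> cl C \<noteq> {}}"
  define \<Delta> where "\<Delta> = (\<Union>\<G>, {e \<in> snd \<Gamma>. e \<subseteq> \<Union>\<G>})"
  have sub: "fst \<Delta> \<subseteq> fst \<Gamma>"
    using graph_components_subset[of _ \<Gamma>] by (auto simp: \<Delta>_def \<G>_def)
  have "spanned_by \<Delta> \<G>"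
  proof -
    have "graph_connected \<Delta> C" if "C \<in> \<G>" for C
    proof (rule graph_connected_mono)
      show "graph_connected \<Gamma> C" using that graph_components_connected[of C \<Gamma>] by (simp add: \<G>_def)
    qed (use that in \<open>auto simp: \<Delta>_def\<close>)
    moreover have "finite \<G>" using \<Gamma>(2) by (simp add: \<G>_def)
    ultimately show ?thesis
      by (auto simp: spanned_by_def \<Delta>_def \<G>_def)
  qed
  moreover have "graph_in M \<Delta>" using \<Gamma>(1) sub by (auto simp: graph_in_def \<Delta>_def)
  moreover have "A \<subseteq> cl (fst \<Delta>)"
  proof
    fix a assume "a \<in> A"
    then obtain C where "C \<in> graph_components \<Gamma>" "a \<in> cl C"
      using spanned_by_cl[OF span, of a] \<Gamma>(3) by blast
    with \<open>a \<in> A\<close> have "C \<subseteq> fst \<Delta>" by (auto simp: \<Delta>_def \<G>_def)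
    with \<open>a \<in> cl C\<close> show "a \<in> cl (fst \<Delta>)" using cl_mono by blast
  qed
  ultimately have "\<Delta> \<in> graphs_linking M d A A"
    using ZX_D(1)[OF A] by (intro graphs_linkingI[of \<Delta> \<G>]) (auto simp: \<G>_def)
  moreover have "graph_length d \<Delta> \<le> graph_length d \<Gamma>"
    by (rule graph_length_mono) (auto simp: \<Delta>_def)
  ultimately show ?thesis using len by (meson le_less_trans)
qed

lemma join_linking:
  assumes \<Gamma>: "\<Gamma> \<in> graphs_linking M d A B" "A \<noteq> {}" and \<Delta>: "\<Delta> \<in> graphs_linking M d B' C" "B' \<noteq> {}"
    and R: "R \<subseteq> graph_components \<Gamma> \<times> graph_components \<Delta>"
      "fst ` R = graph_components \<Gamma>" "snd ` R = graph_components \<Delta>"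
    and short: "\<And>K L. (K, L) \<in> R \<Longrightarrow> \<exists>u\<in>K. \<exists>v\<in>L. d u v \<le> w (K, L)"
  shows "\<exists>\<Lambda>\<in>graphs_linking M d A C.
    graph_length d \<Lambda> \<le> graph_length d \<Gamma> + graph_length d \<Delta> + ennreal (\<Sum>p\<in>R. w p)"
proof -
  note \<Gamma>' = graphs_linkingD[OF \<Gamma>] and \<Delta>' = graphs_linkingD[OF \<Delta>]
  obtain \<Lambda> where \<Lambda>: "graph_in M \<Lambda>" "fst \<Lambda> = fst \<Gamma> \<union> fst \<Delta>"
      "spanned_by \<Lambda> ((\<lambda>(C, D). C \<union> D) ` R)"
      "graph_length d \<Lambda> \<le> graph_length d \<Gamma> + graph_length d \<Delta> + ennreal (\<Sum>p\<in>R. w p)"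
    using join_graphs[OF \<Gamma>'(1,2) \<Delta>'(1,2) R short] by blast
  have "\<Lambda> \<in> graphs_linking M d A C"
  proof (rule graphs_linkingI[OF \<Lambda>(1,3) \<Gamma>(2)])
    show "A \<union> C \<subseteq> cl (fst \<Lambda>)"
      using \<Gamma>'(3) \<Delta>'(3) cl_mono[of "fst \<Gamma>" "fst \<Lambda>"] cl_mono[of "fst \<Delta>" "fst \<Lambda>"] \<Lambda>(2) by auto
  next
    fix N assume "N \<in> (\<lambda>(C, D). C \<union> D) ` R"
    then obtain K L where KL: "(K, L) \<in> R" "N = K \<union> L" by auto
    then have "K \<in> graph_components \<Gamma>" "L \<in> graph_components \<Delta>" using R(1) by auto
    then have "A \<inter> cl K \<noteq> {}" "C \<inter> cl L \<noteq> {}" using \<Gamma>'(4) \<Delta>'(4) by auto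
    then show "A \<inter> cl N \<noteq> {} \<and> C \<inter> cl N \<noteq> {}"
      using cl_mono[of K N] cl_mono[of L N] KL(2) by blast
  qed
  with \<Lambda>(4) show ?thesis by blast
qed

text \<open>
  Short graphs around \<open>A\<close> and around \<open>B\<close> become a linking graph when each component of the
  first is joined to each component of the second.
\<close>

lemma d1ZX_ennreal_finite:
  assumes A: "A \<in> ZX M d" and B: "B \<in> ZX M d"
  shows "d1ZX_ennreal M d A B < \<infinity>"
proof -
  obtain \<Gamma> \<Delta> where \<Gamma>: "\<Gamma> \<in> graphs_linking M d A A" "graph_length d \<Gamma> < ennreal 1"
    and \<Delta>: "\<Delta> \<in> graphs_linking M d B B" "graph_length d \<Delta> < ennreal 1"
    using zero_length_self_linking[OF A, of 1] zero_length_self_linking[OF B, of 1] by auto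
  note ne = ZX_D(1)[OF A] ZX_D(1)[OF B]
  note \<Gamma>' = graphs_linkingD[OF \<Gamma>(1) ne(1)] and \<Delta>' = graphs_linkingD[OF \<Delta>(1) ne(2)]
  define w where "w p = d (SOME x. x \<in> fst p) (SOME x. x \<in> snd p)" for p
  have fst_ne: "graph_components \<Gamma> \<noteq> {}" "graph_components \<Delta> \<noteq> {}"
    using ne \<Gamma>'(2,3) \<Delta>'(2,3) by (auto simp: spanned_by_def)
  have short: "\<exists>u\<in>K. \<exists>v\<in>L. d u v \<le> w (K, L)"
    if "(K, L) \<in> graph_components \<Gamma> \<times> graph_components \<Delta>" for K L
  proof -
    have "K \<noteq> {}" "L \<noteq> {}" using that \<Gamma>'(2) \<Delta>'(2) by (auto simp: spanned_by_def)
    then have "(SOME x. x \<in> K) \<in> K" "(SOME x. x \<in> L) \<in> L" by (simp_all add: some_in_eq)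
    then show ?thesis by (force simp: w_def)
  qed
  let ?R = "graph_components \<Gamma> \<times> graph_components \<Delta>"
  have surj: "fst ` ?R = graph_components \<Gamma>" "snd ` ?R = graph_components \<Delta>"
    using fst_ne by (simp_all add: fst_image_times snd_image_times)
  obtain \<Lambda> where \<Lambda>: "\<Lambda> \<in> graphs_linking M d A B"
    "graph_length d \<Lambda> \<le> graph_length d \<Gamma> + graph_length d \<Delta> + ennreal (\<Sum>p\<in>?R. w p)"
    using join_linking[OF \<Gamma>(1) ne(1) \<Delta>(1) ne(2) subset_refl surj short] by blast
  have "d1ZX_ennreal M d A B \<le> graph_length d \<Lambda>"
    unfolding d1ZX_ennreal_def by (rule INF_lower[OF \<Lambda>(1)])
  also note \<Lambda>(2)
  also have "graph_length d \<Gamma> + graph_length d \<Delta> + ennreal (\<Sum>p\<in>?R. w p) < \<infinity>"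
    using \<Gamma>(2) \<Delta>(2) by (auto simp: less_top[symmetric] dest: less_le_trans[OF _ top_greatest] intro: order_less_trans)
  finally show ?thesis .
qed

lemma d1ZX_le:
  assumes "\<Gamma> \<in> graphs_linking M d A B" "graph_length d \<Gamma> \<le> ennreal r" "0 \<le> r"
  shows "d1ZX M d A B \<le> r"
proof -
  have "d1ZX_ennreal M d A B \<le> graph_length d \<Gamma>"
    unfolding d1ZX_ennreal_def by (rule INF_lower[OF assms(1)])
  then show ?thesis
    unfolding d1ZX_def using assms(2,3) by (intro enn2real_leI) auto
qed

lemma d1ZX_nonneg: "0 \<le> d1ZX S d A B"
  by (simp add: d1ZX_def)

lemma d1ZX_lessE:
  assumes "A \<in> ZX M d" "B \<in> ZX M d" "d1ZX M d A B < r"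
  obtains \<Gamma> where "\<Gamma> \<in> graphs_linking M d A B" "graph_length d \<Gamma> \<le> ennreal r"
proof -
  have "d1ZX_ennreal M d A B = ennreal (d1ZX M d A B)"
    using d1ZX_ennreal_finite[OF assms(1,2)] by (simp add: d1ZX_def)
  also have "\<dots> < ennreal r"
    using assms(3) d1ZX_nonneg[of M A B] by (simp add: ennreal_less_iff)
  finally show ?thesis
    unfolding d1ZX_ennreal_def INF_less_iff using that by (auto intro: less_imp_le)
qed

lemma d1ZX_commute: "d1ZX S d A B = d1ZX S d B A"
proof -
  have "graphs_linking S d A B = graphs_linking S d B A"
    by (auto simp: graphs_linking_def)
  then show ?thesis by (simp add: d1ZX_def d1ZX_ennreal_def)
qed

lemma d1ZX_self:
  assumes "A \<in> ZX M d"
  shows "d1ZX M d A A = 0"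
proof -
  have "d1ZX M d A A \<le> e" if e: "e > 0" for e
  proof -
    obtain \<Gamma> where "\<Gamma> \<in> graphs_linking M d A A" "graph_length d \<Gamma> < ennreal e"
      using zero_length_self_linking[OF assms e] by blast
    then show ?thesis using e by (intro d1ZX_le) auto
  qed
  then have "d1ZX M d A A \<le> 0" using field_le_epsilon[of "d1ZX M d A A" 0] by simp
  then show ?thesis using d1ZX_nonneg[of M A A] by simp
qed

text \<open>
  Two components linked to a common point \<open>b\<close> of \<open>B\<close> need not meet, but both come arbitrarily
  close to \<open>b\<close>. One short edge for each such pair of components joins them; there are only
  finitely many pairs.
\<close>

lemma d1ZX_triangle:
  assumes A: "A \<in> ZX M d" and B: "B \<in> ZX M d" and C: "C \<in> ZX M d"
  shows "d1ZX M d A C \<le> d1ZX M d A B + d1ZX M d B C"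
proof (rule field_le_epsilon)
  fix e :: real assume "e > 0"
  define r s where "r = d1ZX M d A B + e / 3" and "s = d1ZX M d B C + e / 3"
  have rs: "d1ZX M d A B < r" "d1ZX M d B C < s" "0 \<le> r" "0 \<le> s"
    using \<open>e > 0\<close> d1ZX_nonneg[of M A B] d1ZX_nonneg[of M B C] by (auto simp: r_def s_def)
  obtain \<Gamma> where \<Gamma>: "\<Gamma> \<in> graphs_linking M d A B" "graph_length d \<Gamma> \<le> ennreal r"
    using d1ZX_lessE[OF A B rs(1)] .
  obtain \<Delta> where \<Delta>: "\<Delta> \<in> graphs_linking M d B C" "graph_length d \<Delta> \<le> ennreal s"
    using d1ZX_lessE[OF B C rs(2)] .
  note ne = ZX_D(1)[OF A] ZX_D(1)[OF B]
  note \<Gamma>' = graphs_linkingD[OF \<Gamma>(1) ne(1)] and \<Delta>' = graphs_linkingD[OF \<Delta>(1) ne(2)]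
  define R where "R = {p \<in> graph_components \<Gamma> \<times> graph_components \<Delta>.
      B \<inter> cl (fst p) \<inter> cl (snd p) \<noteq> {}}"
  have "\<exists>L. (K, L) \<in> R" if K: "K \<in> graph_components \<Gamma>" for K
  proof -
    obtain b where b: "b \<in> B" "b \<in> cl K" using \<Gamma>'(4)[OF K] by blast
    then obtain L where "L \<in> graph_components \<Delta>" "b \<in> cl L"
      using spanned_by_cl[OF \<Delta>'(2), of b] \<Delta>'(3) by blast
    with b K have "(K, L) \<in> R" by (auto simp: R_def)
    then show ?thesis ..
  qed
  moreover have "\<exists>K. (K, L) \<in> R" if L: "L \<in> graph_components \<Delta>" for L
  proof -
    obtain b where b: "b \<in> B" "b \<in> cl L" using \<Delta>'(4)[OF L] by blast
    then obtain K where "K \<in> graph_components \<Gamma>" "b \<in> cl K"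
      using spanned_by_cl[OF \<Gamma>'(2), of b] \<Gamma>'(3) by blast
    with b L have "(K, L) \<in> R" by (auto simp: R_def)
    then show ?thesis ..
  qed
  moreover have RS: "R \<subseteq> graph_components \<Gamma> \<times> graph_components \<Delta>" by (auto simp: R_def)
  ultimately have surj: "fst ` R = graph_components \<Gamma>" "snd ` R = graph_components \<Delta>"
    by force+
  define \<delta> where "\<delta> = e / 3 / (real (card R) + 1)"
  have "\<delta> > 0" using \<open>e > 0\<close> by (simp add: \<delta>_def add_nonneg_pos)
  have short: "\<exists>u\<in>K. \<exists>v\<in>L. d u v \<le> \<delta>" if KL: "(K, L) \<in> R" for K L
  proof -
    obtain b where b: "b \<in> cl K" "b \<in> cl L" using KL by (auto simp: R_def)
    obtain u where u: "u \<in> K" "u \<in> M" "d b u < \<delta> / 2"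
      using b(1) \<open>\<delta> > 0\<close> unfolding in_cl_iff by (meson half_gt_zero)
    obtain v where v: "v \<in> L" "v \<in> M" "d b v < \<delta> / 2"
      using b(2) \<open>\<delta> > 0\<close> unfolding in_cl_iff by (meson half_gt_zero)
    have "d u v \<le> d u b + d b v" using u v b by (intro triangle) (auto simp: in_cl_iff)
    with u v show ?thesis by (intro bexI[of _ u] bexI[of _ v]) (auto simp: commute)
  qed
  obtain \<Lambda> where \<Lambda>: "\<Lambda> \<in> graphs_linking M d A C"
    "graph_length d \<Lambda> \<le> graph_length d \<Gamma> + graph_length d \<Delta> + ennreal (\<Sum>p\<in>R. \<delta>)"
    using join_linking[OF \<Gamma>(1) ne(1) \<Delta>(1) ne(2) RS surj short] by blast
  have "(\<Sum>p\<in>R. \<delta>) \<le> e / 3"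
    using \<open>e > 0\<close> by (simp add: \<delta>_def field_simps)
  then have "graph_length d \<Lambda> \<le> ennreal r + ennreal s + ennreal (e / 3)"
    using \<Lambda>(2) \<Gamma>(2) \<Delta>(2) by (meson add_mono ennreal_leI order_trans)
  also have "\<dots> = ennreal (r + s + e / 3)"
    using rs \<open>e > 0\<close> by (simp flip: ennreal_plus)
  finally have "d1ZX M d A C \<le> r + s + e / 3"
    using rs \<open>e > 0\<close> by (intro d1ZX_le[OF \<Lambda>(1)]) auto
  then show "d1ZX M d A C \<le> d1ZX M d A B + d1ZX M d B C + e"
    by (simp add: r_def s_def)
qed

text \<open>
  Both \<open>a\<close> and some point of \<open>B\<close> lie in the closure of one component, a set of diameter
  at most the length of the graph.
\<close>

lemma d1ZX_near:
  assumes "A \<in> ZX M d" "B \<in> ZX M d" "d1ZX M d A B < r" "a \<in> A"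
  shows "\<exists>b\<in>B. d a b \<le> r"
proof -
  have "0 \<le> r" using assms(3) d1ZX_nonneg[of M A B] by linarith
  obtain \<Gamma> where \<Gamma>: "\<Gamma> \<in> graphs_linking M d A B" "graph_length d \<Gamma> \<le> ennreal r"
    using d1ZX_lessE[OF assms(1-3)] .
  note \<Gamma>' = graphs_linkingD[OF \<Gamma>(1) ZX_D(1)[OF assms(1)]]
  obtain C where C: "C \<in> graph_components \<Gamma>" "a \<in> cl C"
    using spanned_by_cl[OF \<Gamma>'(2), of a] \<Gamma>'(3) assms(4) by blast
  obtain b where "b \<in> B" "b \<in> cl C" using \<Gamma>'(4)[OF C(1)] by blast
  with graph_connected_distance_cl_le[OF \<Gamma>'(1) \<Gamma>(2) \<open>0 \<le> r\<close> graph_components_connected[OF C(1)] C(2)]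
  show ?thesis by blast
qed

lemma ZX_cl: "A \<in> ZX M d \<Longrightarrow> cl A = A"
  using ZX_D(3) Hausdorff_space_mtopology
  by (simp add: closure_of_eq compactin_imp_closedin)

lemma d1ZX_zero_subset:
  assumes "A \<in> ZX M d" "B \<in> ZX M d" "d1ZX M d A B = 0"
  shows "A \<subseteq> B"
proof
  fix a assume a: "a \<in> A"
  have "\<exists>b\<in>B. b \<in> M \<and> d a b < r" if "r > 0" for r
    using d1ZX_near[OF assms(1,2) _ a, of "r/2"] that assms(3) ZX_D(2)[OF assms(2)] by force
  then have "a \<in> cl B" using a ZX_D(2)[OF assms(1)] by (auto simp: in_cl_iff)
  then show "a \<in> B" using ZX_cl[OF assms(2)] by simp
qed

theorem Metric_space_d1ZX: "Metric_space (ZX M d) (d1ZX M d)"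
proof
  show "d1ZX M d A B = 0 \<longleftrightarrow> A = B" if "A \<in> ZX M d" "B \<in> ZX M d" for A B
    using that d1ZX_zero_subset[of A B] d1ZX_zero_subset[of B A] d1ZX_self[of A]
      d1ZX_commute[of M A B] by auto
qed (rule d1ZX_nonneg d1ZX_commute d1ZX_triangle; assumption?)+

theorem dKX_le_d1ZX:
  assumes A: "A \<in> ZX M d" and B: "B \<in> ZX M d"
  shows "dKX d A B \<le> d1ZX M d A B"
proof -
  have half: "(SUP a\<in>A. INF b\<in>B. d a b) \<le> d1ZX M d A B"
    if A: "A \<in> ZX M d" and B: "B \<in> ZX M d" for A B
  proof (rule cSUP_least)
    fix a assume a: "a \<in> A"
    show "(INF b\<in>B. d a b) \<le> d1ZX M d A B"
    proof (rule field_le_epsilon)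
      fix e :: real assume "e > 0"
      then obtain b where b: "b \<in> B" "d a b \<le> d1ZX M d A B + e"
        using d1ZX_near[OF A B _ a, of "d1ZX M d A B + e"] by auto
      have "(INF b\<in>B. d a b) \<le> d a b"
        using b(1) by (intro cINF_lower) (auto intro!: bdd_belowI[of _ 0])
      with b(2) show "(INF b\<in>B. d a b) \<le> d1ZX M d A B + e" by linarith
    qed
  qed (rule ZX_D(1)[OF A])
  show ?thesis
    unfolding dKX_def using half[OF A B] half[OF B A] by (simp add: d1ZX_commute[of M B A])
qed

section \<open>Finite sets\<close>

text \<open>
  Representatives of the components of a short graph that links \<open>A\<close> to itself form a finite set
  that the same graph links to \<open>A\<close>.
\<close>

lemma finite_set_near_ZX:
  assumes A: "A \<in> ZX M d" and "e > 0"
  shows "\<exists>F\<in>FX M. d1ZX M d A F < e"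
proof -
  obtain \<Gamma> where \<Gamma>: "\<Gamma> \<in> graphs_linking M d A A" "graph_length d \<Gamma> < ennreal (e / 2)"
    using zero_length_self_linking[OF A, of "e/2"] \<open>e > 0\<close> by auto
  note ne = ZX_D(1)[OF A]
  note \<Gamma>' = graphs_linkingD[OF \<Gamma>(1) ne]
  have V: "fst \<Gamma> \<subseteq> M" using \<Gamma>'(1) by (simp add: graph_in_iff)
  define F where "F = (\<lambda>C. SOME x. x \<in> C) ` graph_components \<Gamma>"
  have rep: "(SOME x. x \<in> C) \<in> C" if "C \<in> graph_components \<Gamma>" for C
    using \<Gamma>'(2) that by (simp add: some_in_eq spanned_by_def)
  have FV: "F \<subseteq> fst \<Gamma>"
    unfolding F_def using rep graph_components_subset[of _ \<Gamma>] by blast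
  have "fst \<Gamma> \<noteq> {}" using ne \<Gamma>'(3) by auto
  then have "F \<in> FX M"
    using FV V \<Gamma>'(2) by (auto simp: FX_def F_def spanned_by_def)
  moreover have "\<Gamma> \<in> graphs_linking M d A F"
  proof (rule graphs_linkingI[OF \<Gamma>'(1,2) ne])
    show "A \<union> F \<subseteq> cl (fst \<Gamma>)" using \<Gamma>'(3) FV subset_cl[OF V] by auto
  next
    fix C assume C: "C \<in> graph_components \<Gamma>"
    then have "C \<subseteq> cl C" using V graph_components_subset[OF C] by (intro subset_cl) auto
    then show "A \<inter> cl C \<noteq> {} \<and> F \<inter> cl C \<noteq> {}"
      using \<Gamma>'(4)[OF C] rep[OF C] C by (auto simp: F_def)
  qed
  then have "d1ZX M d A F \<le> e / 2" using \<Gamma>(2) \<open>e > 0\<close> by (intro d1ZX_le) auto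
  ultimately show ?thesis using \<open>e > 0\<close> by (intro bexI[of _ F]) auto
qed

text \<open>
  For finite sets, the linking graph can be made to contain the points of both sets. Unlike the
  closure conditions, this can be preserved when passing to a finite subgraph.
\<close>

definition graphs_joining :: "'a set \<Rightarrow> 'a set \<Rightarrow> 'a ugraph set" where
  "graphs_joining A B = {\<Gamma>. graph_in M \<Gamma> \<and> A \<union> B \<subseteq> fst \<Gamma> \<and> finite (graph_components \<Gamma>) \<and>
     (\<forall>C\<in>graph_components \<Gamma>. A \<inter> C \<noteq> {} \<and> B \<inter> C \<noteq> {})}"

lemma graphs_joiningI:
  assumes "graph_in M \<Gamma>" "spanned_by \<Gamma> \<C>" "A \<union> B \<subseteq> fst \<Gamma>" "A \<noteq> {}"
    and "\<And>C. C \<in> \<C> \<Longrightarrow> A \<inter> C \<noteq> {} \<and> B \<inter> C \<noteq> {}"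
  shows "\<Gamma> \<in> graphs_joining A B"
proof -
  have ne: "fst \<Gamma> \<noteq> {}" using assms(3,4) by auto
  have "A \<inter> K \<noteq> {} \<and> B \<inter> K \<noteq> {}" if K: "K \<in> graph_components \<Gamma>" for K
    using spanned_by_component_contains[OF assms(2) ne K] assms(5) by blast
  then show ?thesis
    using assms spanned_by_finite_components[OF assms(2) ne] by (simp add: graphs_joining_def)
qed

lemma graphs_joiningD:
  assumes "\<Gamma> \<in> graphs_joining A B" "A \<noteq> {}"
  shows "graph_in M \<Gamma>" "spanned_by \<Gamma> (graph_components \<Gamma>)" "A \<union> B \<subseteq> fst \<Gamma>"
    "\<And>C. C \<in> graph_components \<Gamma> \<Longrightarrow> A \<inter> C \<noteq> {} \<and> B \<inter> C \<noteq> {}"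
proof -
  show "graph_in M \<Gamma>" and AB: "A \<union> B \<subseteq> fst \<Gamma>"
    and "\<And>C. C \<in> graph_components \<Gamma> \<Longrightarrow> A \<inter> C \<noteq> {} \<and> B \<inter> C \<noteq> {}"
    using assms(1) by (auto simp: graphs_joining_def)
  have "fst \<Gamma> \<noteq> {}" using AB assms(2) by auto
  then show "spanned_by \<Gamma> (graph_components \<Gamma>)"
    using assms(1) by (intro spanned_by_components) (auto simp: graphs_joining_def)
qed

lemma graphs_joining_linking:
  assumes "\<Gamma> \<in> graphs_joining A B" "A \<noteq> {}"
  shows "\<Gamma> \<in> graphs_linking M d A B"
proof -
  note \<Gamma>' = graphs_joiningD[OF assms]
  have V: "fst \<Gamma> \<subseteq> M" using \<Gamma>'(1) by (simp add: graph_in_iff)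
  show ?thesis
  proof (rule graphs_linkingI[OF \<Gamma>'(1,2) assms(2)])
    show "A \<union> B \<subseteq> cl (fst \<Gamma>)" using \<Gamma>'(3) subset_cl[OF V] by auto
  next
    fix C assume C: "C \<in> graph_components \<Gamma>"
    then have "C \<subseteq> cl C" using V graph_components_subset[OF C] by (intro subset_cl) auto
    then show "A \<inter> cl C \<noteq> {} \<and> B \<inter> cl C \<noteq> {}" using \<Gamma>'(4)[OF C] by blast
  qed
qed

text \<open>
  A finite set is a graph of isolated points, of length zero.
\<close>

lemma graphs_joining_self:
  assumes "F \<in> FX M"
  shows "(F, {}) \<in> graphs_joining F F"
  using assms
  by (intro graphs_joiningI[of _ "(\<lambda>x. {x}) ` F"])
    (auto simp: graph_in_iff spanned_by_def FX_def intro: graph_connected_singleton)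

lemma FX_subset_ZX: "FX M \<subseteq> ZX M d"
proof
  fix F assume F: "F \<in> FX M"
  then have F': "F \<noteq> {}" "finite F" "F \<subseteq> M" by (auto simp: FX_def)
  have "(F, {}) \<in> graphs_linking M d F F"
    using graphs_joining_linking[OF graphs_joining_self[OF F] F'(1)] .
  then have "(F, {}) \<in> graphs_covering M d F"
    by (simp add: graphs_linking_def graphs_covering_def)
  then have "zero_length M d F"
    unfolding zero_length_def by (auto intro!: bexI[of _ "(F, {})"] simp: graph_length_no_edges)
  moreover have "compactin mtopology F" using F' by (intro finite_imp_compactin) auto
  ultimately show "F \<in> ZX M d" using F'(1) by (simp add: ZX_def KX_def)
qed

theorem dense_subset_FX: "dense_subset (ZX M d) (d1ZX M d) (FX M)"
proof -
  interpret Z: Metric_space "ZX M d" "d1ZX M d" by (rule Metric_space_d1ZX)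
  have "A \<in> Z.cl (FX M)" if "A \<in> ZX M d" for A
    using that finite_set_near_ZX[OF that] FX_subset_ZX by (fastforce simp: Z.in_cl_iff)
  moreover have "Z.cl (FX M) \<subseteq> ZX M d" by (auto simp: Z.in_cl_iff)
  ultimately show ?thesis using FX_subset_ZX by (auto simp: dense_subset_def)
qed

text \<open>
  Each point of \<open>F \<union> G\<close> is attached by a short edge to every component whose closure contains
  it. A component of the resulting graph contains some old component \<open>K\<close>, and therefore all the
  points attached to \<open>K\<close>, among them points of \<open>F\<close> and of \<open>G\<close>.
\<close>

lemma d1ZX_less_joiningE:
  assumes F: "F \<in> FX M" and G: "G \<in> FX M" and r: "d1ZX M d F G < r"
  obtains \<Gamma> where "\<Gamma> \<in> graphs_joining F G" "graph_length d \<Gamma> \<le> ennreal r"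
proof -
  obtain s where s: "d1ZX M d F G < s" "s < r" using r dense by blast
  have "0 \<le> s" using s(1) d1ZX_nonneg[of M F G] by linarith
  obtain \<Gamma> where \<Gamma>: "\<Gamma> \<in> graphs_linking M d F G" "graph_length d \<Gamma> \<le> ennreal s"
    using d1ZX_lessE[of F G s] FX_subset_ZX F G s(1) by blast
  have F': "F \<noteq> {}" "finite F" "F \<subseteq> M" and G': "finite G" "G \<subseteq> M"
    using F G by (auto simp: FX_def)
  note \<Gamma>' = graphs_linkingD[OF \<Gamma>(1) F'(1)]
  define \<Delta> where "\<Delta> = (F \<union> G, {} :: 'a set set)"
  define \<D> where "\<D> = (\<lambda>x. {x}) ` (F \<union> G)"
  have \<Delta>: "graph_in M \<Delta>" "spanned_by \<Delta> \<D>"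
    using F' G' by (auto simp: \<Delta>_def \<D>_def graph_in_iff spanned_by_def intro: graph_connected_singleton)
  define R where "R = {p \<in> graph_components \<Gamma> \<times> \<D>. snd p \<inter> cl (fst p) \<noteq> {}}"
  have RS: "R \<subseteq> graph_components \<Gamma> \<times> \<D>" by (auto simp: R_def)
  have R1: "(K, {x}) \<in> R" if "K \<in> graph_components \<Gamma>" "x \<in> F \<union> G" "x \<in> cl K" for K x
    using that by (auto simp: R_def \<D>_def)
  have "\<exists>L. (K, L) \<in> R" if K: "K \<in> graph_components \<Gamma>" for K
    using R1[OF K] \<Gamma>'(4)[OF K] by blast
  moreover have "\<exists>K. (K, L) \<in> R" if L: "L \<in> \<D>" for L
  proof -
    obtain x where x: "L = {x}" "x \<in> F \<union> G" using L by (auto simp: \<D>_def)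
    then obtain K where "K \<in> graph_components \<Gamma>" "x \<in> cl K"
      using spanned_by_cl[OF \<Gamma>'(2), of x] \<Gamma>'(3) by blast
    then show ?thesis using R1 x by blast
  qed
  ultimately have surj: "fst ` R = graph_components \<Gamma>" "snd ` R = \<D>"
    using RS by force+
  define \<delta> where "\<delta> = (r - s) / (real (card R) + 1)"
  have "\<delta> > 0" using s by (simp add: \<delta>_def add_nonneg_pos)
  have short: "\<exists>u\<in>K. \<exists>v\<in>L. d u v \<le> \<delta>" if KL: "(K, L) \<in> R" for K L
  proof -
    obtain x where x: "L = {x}" "x \<in> cl K" using KL by (auto simp: R_def \<D>_def)
    then obtain u where "u \<in> K" "d x u < \<delta>" using \<open>\<delta> > 0\<close> by (auto simp: in_cl_iff)
    with x(1) show ?thesis using commute[of u x] by (intro bexI[of _ u] bexI[of _ x]) auto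
  qed
  obtain \<Lambda> where \<Lambda>: "graph_in M \<Lambda>" "fst \<Lambda> = fst \<Gamma> \<union> fst \<Delta>"
      "spanned_by \<Lambda> ((\<lambda>(C, D). C \<union> D) ` R)"
      "graph_length d \<Lambda> \<le> graph_length d \<Gamma> + graph_length d \<Delta> + ennreal (\<Sum>p\<in>R. \<delta>)"
    using join_graphs[OF \<Gamma>'(1,2) \<Delta> RS surj short] by blast
  have ne: "fst \<Lambda> \<noteq> {}" using \<Lambda>(2) F'(1) by (auto simp: \<Delta>_def)
  have meet: "F \<inter> N \<noteq> {} \<and> G \<inter> N \<noteq> {}" if N: "N \<in> graph_components \<Lambda>" for N
  proof -
    obtain K L where KL: "(K, L) \<in> R" "K \<union> L \<subseteq> N"
      using spanned_by_component_contains[OF \<Lambda>(3) ne N] by auto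
    then have K: "K \<in> graph_components \<Gamma>" "K \<noteq> {}"
      using RS \<Gamma>'(2) by (auto simp: spanned_by_def)
    have "x \<in> N" if x: "x \<in> F \<union> G" "x \<in> cl K" for x
    proof -
      have "K \<union> {x} \<in> (\<lambda>(C, D). C \<union> D) ` R"
        by (rule image_eqI[OF _ R1[OF K(1) x]]) simp
      moreover have "\<forall>C\<in>(\<lambda>(C, D). C \<union> D) ` R. graph_connected \<Lambda> C"
        using \<Lambda>(3) by (simp add: spanned_by_def)
      ultimately have "graph_connected \<Lambda> (K \<union> {x})" by (metis (lifting))
      moreover have "N \<inter> (K \<union> {x}) \<noteq> {}" using KL(2) K(2) by auto
      ultimately have "K \<union> {x} \<subseteq> N" by (rule graph_components_absorb[OF N])
      then show ?thesis by blast
    qed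
    then show ?thesis using \<Gamma>'(4)[OF K(1)] by blast
  qed
  then have "\<Lambda> \<in> graphs_joining F G"
    using \<Lambda>(1,2) spanned_by_finite_components[OF \<Lambda>(3) ne] by (auto simp: graphs_joining_def \<Delta>_def)
  moreover have "graph_length d \<Lambda> \<le> ennreal r"
  proof -
    have "(\<Sum>p\<in>R. \<delta>) \<le> r - s"
      using s by (simp add: \<delta>_def field_simps)
    moreover have "graph_length d \<Delta> \<le> 0" by (simp add: graph_length_no_edges \<Delta>_def)
    ultimately have "graph_length d \<Lambda> \<le> ennreal s + 0 + ennreal (r - s)"
      using \<Lambda>(4) \<Gamma>(2) by (meson add_mono ennreal_leI order_trans)
    also have "\<dots> = ennreal r" using s(2) \<open>0 \<le> s\<close> by (simp flip: ennreal_plus)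
    finally show ?thesis .
  qed
  ultimately show ?thesis by (rule that)
qed

lemma component_trees:
  assumes "\<Gamma> \<in> graphs_joining F G" "F \<noteq> {}" "finite F" "finite G"
  obtains V T where "\<And>C. C \<in> graph_components \<Gamma> \<Longrightarrow>
    grown_tree (V C) (T C) \<and> (F \<union> G) \<inter> C \<subseteq> V C \<and> V C \<subseteq> C \<and> T C \<subseteq> snd \<Gamma>"
proof -
  have "\<exists>VT. grown_tree (fst VT) (snd VT) \<and> (F \<union> G) \<inter> C \<subseteq> fst VT \<and> fst VT \<subseteq> C \<and> snd VT \<subseteq> snd \<Gamma>"
    if C: "C \<in> graph_components \<Gamma>" for C
  proof -
    have "finite ((F \<union> G) \<inter> C)" "(F \<union> G) \<inter> C \<noteq> {}"
      using assms(3,4) graphs_joiningD(4)[OF assms(1,2) C] by auto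
    from grown_tree_through_finite_set[OF this _ graph_components_connected[OF C]]
    show ?thesis by fastforce
  qed
  then obtain VT where "\<And>C. C \<in> graph_components \<Gamma> \<Longrightarrow> grown_tree (fst (VT C)) (snd (VT C)) \<and>
      (F \<union> G) \<inter> C \<subseteq> fst (VT C) \<and> fst (VT C) \<subseteq> C \<and> snd (VT C) \<subseteq> snd \<Gamma>"
    by metis
  then show ?thesis using that[of "\<lambda>C. fst (VT C)" "\<lambda>C. snd (VT C)"] by blast
qed

text \<open>
  Component by component, a tree inside the component transports the part of \<open>F\<close> there to the
  part of \<open>G\<close> there, while everything else is stationary.
\<close>

lemma nonexpanding_le_joining:
  assumes \<sigma>: "Metric_space (FX M) \<sigma>" "l1_nonexpanding M d \<sigma>"
    and F: "F \<in> FX M" and G: "G \<in> FX M"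
    and \<Gamma>: "\<Gamma> \<in> graphs_joining F G" "graph_length d \<Gamma> \<le> ennreal r" "0 \<le> r"
  shows "\<sigma> F G \<le> r"
proof -
  have F': "F \<noteq> {}" "finite F" "F \<subseteq> M" and G': "finite G" "G \<subseteq> M"
    using F G by (auto simp: FX_def)
  note \<Gamma>' = graphs_joiningD[OF \<Gamma>(1) F'(1)]
  have VM: "fst \<Gamma> \<subseteq> M" using \<Gamma>'(1) by (simp add: graph_in_iff)
  obtain V T where VT: "\<And>C. C \<in> graph_components \<Gamma> \<Longrightarrow>
    grown_tree (V C) (T C) \<and> (F \<union> G) \<inter> C \<subseteq> V C \<and> V C \<subseteq> C \<and> T C \<subseteq> snd \<Gamma>"
    using component_trees[OF \<Gamma>(1) F'(1,2) G'(1)] by blast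
  let ?l = "\<lambda>E. \<Sum>e\<in>E. edge_length d e"
  have tree: "\<sigma> ((F \<inter> C) \<union> W) ((G \<inter> C) \<union> W) \<le> ?l (T C)"
    if C: "C \<in> graph_components \<Gamma>" and W: "finite W" "W \<subseteq> M" for C W
  proof (rule nonexpanding_le_grown_tree[OF \<sigma> _ _ _ _ _ _ W])
    show "V C \<subseteq> M" using VT[OF C] graph_components_subset[OF C] VM by blast
  qed (use VT[OF C] \<Gamma>'(4)[OF C] in auto)
  have transport: "\<sigma> ((F \<inter> \<Union>\<S>) \<union> W) ((G \<inter> \<Union>\<S>) \<union> W) \<le> (\<Sum>C\<in>\<S>. ?l (T C))"
    if "finite \<S>" "\<S> \<noteq> {}" "\<S> \<subseteq> graph_components \<Gamma>" "finite W" "W \<subseteq> M" for \<S> W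
    using that
  proof (induction arbitrary: W rule: finite_ne_induct)
    case (singleton C)
    then show ?case using tree[of C W] by simp
  next
    case (insert C \<S>)
    let ?P = "(F \<inter> C) \<union> ((F \<inter> \<Union>\<S>) \<union> W)" and ?Q = "(G \<inter> C) \<union> ((F \<inter> \<Union>\<S>) \<union> W)"
      and ?R = "(G \<inter> \<Union>\<S>) \<union> ((G \<inter> C) \<union> W)"
    have C: "C \<in> graph_components \<Gamma>" "\<S> \<subseteq> graph_components \<Gamma>" using insert.prems by auto
    have 1: "\<sigma> ?P ?Q \<le> ?l (T C)"
      using C F' insert.prems by (intro tree) auto
    have "\<sigma> ((F \<inter> \<Union>\<S>) \<union> ((G \<inter> C) \<union> W)) ?R \<le> (\<Sum>C\<in>\<S>. ?l (T C))"
      using C(2) G' insert.prems by (intro insert.IH) auto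
    then have 2: "\<sigma> ?Q ?R \<le> (\<Sum>C\<in>\<S>. ?l (T C))" by (simp only: Un_left_commute)
    have "?P \<in> FX M" "?Q \<in> FX M" "?R \<in> FX M"
      using \<Gamma>'(4)[OF C(1)] F' G' insert.prems by (auto simp: FX_def)
    then have "\<sigma> ?P ?R \<le> \<sigma> ?P ?Q + \<sigma> ?Q ?R" by (rule Metric_space.triangle[OF \<sigma>(1)])
    with 1 2 have "\<sigma> ?P ?R \<le> ?l (T C) + (\<Sum>C\<in>\<S>. ?l (T C))" by linarith
    moreover have "?P = (F \<inter> \<Union>(insert C \<S>)) \<union> W" "?R = (G \<inter> \<Union>(insert C \<S>)) \<union> W" by auto
    ultimately show ?case using insert.hyps by simp
  qed
  have fin: "finite (graph_components \<Gamma>)" and un: "\<Union>(graph_components \<Gamma>) = fst \<Gamma>"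
    using \<Gamma>'(2) by (auto simp: spanned_by_def)
  then have "graph_components \<Gamma> \<noteq> {}" using \<Gamma>'(3) F'(1) by auto
  from transport[OF fin this subset_refl, of "{}"]
  have "\<sigma> (F \<inter> fst \<Gamma>) (G \<inter> fst \<Gamma>) \<le> (\<Sum>C\<in>graph_components \<Gamma>. ?l (T C))" by (simp add: un)
  moreover have "F \<inter> fst \<Gamma> = F" "G \<inter> fst \<Gamma> = G" using \<Gamma>'(3) by auto
  moreover have "(\<Sum>C\<in>graph_components \<Gamma>. ?l (T C)) = ?l (\<Union>C\<in>graph_components \<Gamma>. T C)"
  proof (rule sum.UNION_disjoint[symmetric, OF fin])
    show "\<forall>C\<in>graph_components \<Gamma>. finite (T C)" using VT grown_tree_basic(3) by blast
    show "\<forall>C\<in>graph_components \<Gamma>. \<forall>D\<in>graph_components \<Gamma>. C \<noteq> D \<longrightarrow> T C \<inter> T D = {}"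
    proof (intro ballI impI)
      fix C D assume C: "C \<in> graph_components \<Gamma>" and D: "D \<in> graph_components \<Gamma>" and "C \<noteq> D"
      then have disj: "C \<inter> D = {}" using graph_components_disjoint[OF C D] by blast
      have "False" if e: "e \<in> T C" "e \<in> T D" for e
      proof -
        have "e \<subseteq> C" "e \<subseteq> D"
          using e VT[OF C] VT[OF D] grown_tree_basic(4)[of "V C" "T C"] grown_tree_basic(4)[of "V D" "T D"]
          by blast+
        moreover have "e \<in> snd \<Gamma>" using e VT[OF C] by blast
        then have "e \<noteq> {}" using \<Gamma>'(1) by (auto simp: graph_in_def)
        ultimately show False using disj by blast
      qed
      then show "T C \<inter> T D = {}" by blast
    qed
  qed
  moreover have "?l (\<Union>C\<in>graph_components \<Gamma>. T C) \<le> r"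
  proof (rule sum_edge_length_le[OF \<Gamma>'(1) \<Gamma>(2,3)])
    show "finite (\<Union>C\<in>graph_components \<Gamma>. T C)"
      using fin VT grown_tree_basic(3) by blast
    show "(\<Union>C\<in>graph_components \<Gamma>. T C) \<subseteq> snd \<Gamma>" using VT by blast
  qed
  ultimately show ?thesis by simp
qed

text \<open>
  The edges between corresponding entries of two lists form a linking graph.
\<close>

lemma l1_nonexpanding_d1ZX: "l1_nonexpanding M d (d1ZX M d)"
  unfolding l1_nonexpanding_def
proof (intro allI impI)
  fix n :: nat and x y :: "'a list"
  assume "1 \<le> n" and "length x = n \<and> length y = n \<and> set x \<subseteq> M \<and> set y \<subseteq> M"
  then have n: "x \<noteq> []" and xy: "length x = n" "length y = n" "set x \<subseteq> M" "set y \<subseteq> M" by auto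
  define \<Gamma> where "\<Gamma> = (set x \<union> set y, (\<lambda>i. {x ! i, y ! i}) ` {..<n})"
  define \<C> where "\<C> = (\<lambda>i. {x ! i, y ! i}) ` {..<n}"
  have set: "set x = (\<lambda>i. x ! i) ` {..<n}" "set y = (\<lambda>i. y ! i) ` {..<n}"
    using xy by (auto simp: set_conv_nth)
  have "graph_in M \<Gamma>"
    using xy by (auto simp: graph_in_iff \<Gamma>_def set)
  moreover have "spanned_by \<Gamma> \<C>"
  proof -
    have "graph_connected \<Gamma> {x ! i, y ! i}" if "i < n" for i
      using that by (intro graph_connected_edge) (auto simp: \<Gamma>_def set)
    then show ?thesis by (auto simp: spanned_by_def \<Gamma>_def \<C>_def set)
  qed
  ultimately have "\<Gamma> \<in> graphs_joining (set x) (set y)"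
    using n xy by (intro graphs_joiningI[of \<Gamma> \<C>]) (auto simp: \<C>_def \<Gamma>_def)
  then have "\<Gamma> \<in> graphs_linking M d (set x) (set y)" using n by (intro graphs_joining_linking) auto
  moreover have "graph_length d \<Gamma> \<le> ennreal (\<Sum>i<n. d (x ! i) (y ! i))"
    unfolding \<Gamma>_def by (rule graph_length_added_edges) simp
  ultimately show "d1ZX M d (set x) (set y) \<le> (\<Sum>i<n. d (x ! i) (y ! i))"
    by (rule d1ZX_le) (simp add: sum_nonneg)
qed

text \<open>
  The distance of linking graphs is itself a non-expanding metric, so it is at most the largest
  one; conversely, any non-expanding metric is bounded by the length of a joining graph.
\<close>

theorem d1ZX_eq_d1FX:
  assumes F: "F \<in> FX M" and G: "G \<in> FX M"
  shows "d1ZX M d F G = d1FX M d F G"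
proof (rule antisym)
  have largest: "is_largest_FX_metric M d (d1FX M d)"
    by (rule is_largest_FX_metric_d1FX[OF Metric_space_axioms])
  have "Metric_space (FX M) (d1ZX M d)"
    using Metric_space.subspace[OF Metric_space_d1ZX FX_subset_ZX] .
  then show "d1ZX M d F G \<le> d1FX M d F G"
    using largest l1_nonexpanding_d1ZX F G by (auto simp: is_largest_FX_metric_def)
  show "d1FX M d F G \<le> d1ZX M d F G"
  proof (rule field_le_epsilon)
    fix e :: real assume "e > 0"
    then have less: "d1ZX M d F G < d1ZX M d F G + e" by simp
    obtain \<Gamma> where \<Gamma>: "\<Gamma> \<in> graphs_joining F G" "graph_length d \<Gamma> \<le> ennreal (d1ZX M d F G + e)"
      using d1ZX_less_joiningE[OF F G less] .
    show "d1FX M d F G \<le> d1ZX M d F G + e"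
    proof (rule nonexpanding_le_joining[OF _ _ F G \<Gamma>])
      show "Metric_space (FX M) (d1FX M d)" "l1_nonexpanding M d (d1FX M d)"
        using largest by (simp_all add: is_largest_FX_metric_def)
      show "0 \<le> d1ZX M d F G + e" using \<open>e > 0\<close> d1ZX_nonneg[of M F G] by simp
    qed
  qed
qed

section \<open>Completeness\<close>


text \<open>
  The limit of finite sets \<open>F n\<close> joined consecutively by graphs \<open>G n\<close> of summable lengths is the
  set of points approached by the vertices of the tails \<open>H n\<close> of the sequence of graphs. A tail
  is short and every vertex of it is connected in it to one of the finitely many points of \<open>F n\<close>;
  conversely, walking from a point of \<open>F n\<close> through \<open>F (n + 1)\<close>, \<open>F (n + 2)\<close> and so on leads to a
  point of the limit set. Hence \<open>H n\<close> links \<open>F n\<close> to the limit set. The same graphs show that the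
  limit set is totally bounded and has zero length.
\<close>

lemma limit_of_joined_finite_sets:
  assumes "mcomplete" and F: "\<And>n. F n \<in> FX M"
    and close: "\<And>n. d1ZX M d (F n) (F (Suc n)) < (1/2) ^ n"
  shows "\<exists>A\<in>ZX M d. \<forall>n. d1ZX M d (F n) A \<le> 2 * (1/2) ^ n"
proof -
  have "\<exists>\<Gamma>. \<Gamma> \<in> graphs_joining (F n) (F (Suc n)) \<and> graph_length d \<Gamma> \<le> ennreal ((1/2) ^ n)" for n
    using d1ZX_less_joiningE[OF F F close, of n] by blast
  then obtain G where G: "\<And>n. G n \<in> graphs_joining (F n) (F (Suc n))"
      and G_len: "\<And>n. graph_length d (G n) \<le> ennreal ((1/2) ^ n)"
    by metis
  have Fne: "F n \<noteq> {}" and Ffin: "finite (F n)" for n using F[of n] by (auto simp: FX_def)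
  note G' = graphs_joiningD[OF G Fne]
  have FG: "F n \<subseteq> fst (G n)" for n using G'(3)[of n] by blast
  define H where "H n = (\<Union>k\<in>{n..}. fst (G k), \<Union>k\<in>{n..}. snd (G k))" for n
  have GH: "fst (G k) \<subseteq> fst (H n)" "snd (G k) \<subseteq> snd (H n)" if "n \<le> k" for n k
    using that by (auto simp: H_def)
  have H: "graph_in M (H n)" for n
    using G'(1) unfolding graph_in_def H_def by fastforce
  have H_sub: "fst (H n) \<subseteq> M" for n using H[of n] by (simp add: graph_in_iff)
  have H_len: "graph_length d (H n) \<le> ennreal (2 * (1/2) ^ n)" for n
  proof -
    \<comment> \<open>the geometric sum of the lengths, in closed form\<close>
    have part: "graph_length d ({}, \<Union>k\<in>{n..<n+m}. snd (G k))
        \<le> ennreal (2 * (1/2) ^ n - 2 * (1/2) ^ (n + m))" for m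
    proof (induction m)
      case 0
      show ?case by (simp add: graph_length_no_edges)
    next
      case (Suc m)
      have "graph_length d ({}, \<Union>k\<in>{n..<n+Suc m}. snd (G k))
          \<le> graph_length d ({}, \<Union>k\<in>{n..<n+m}. snd (G k)) + graph_length d (G (n + m))"
        by (rule graph_length_Un) (auto simp: atLeastLessThanSuc)
      also have "\<dots> \<le> ennreal (2 * (1/2) ^ n - 2 * (1/2) ^ (n + m)) + ennreal ((1/2) ^ (n + m))"
        by (intro add_mono Suc.IH G_len)
      also have "\<dots> = ennreal (2 * (1/2) ^ n - 2 * (1/2) ^ (n + m) + (1/2) ^ (n + m))"
        by (intro ennreal_plus[symmetric]) (simp_all add: power_decreasing)
      also have "\<dots> = ennreal (2 * (1/2) ^ n - 2 * (1/2) ^ (n + Suc m))" by simp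
      finally show ?case .
    qed
    show ?thesis
      unfolding graph_length_le_iff
    proof (intro allI impI)
      fix X assume X: "finite X" "X \<subseteq> snd (H n)"
      then have "\<forall>e\<in>X. \<exists>k. n \<le> k \<and> e \<in> snd (G k)" by (auto simp: H_def)
      then obtain f where f: "\<And>e. e \<in> X \<Longrightarrow> n \<le> f e \<and> e \<in> snd (G (f e))" by metis
      obtain m where "\<forall>i\<in>f ` X. i < m" using X(1) finite_nat_set_iff_bounded by blast
      then have "X \<subseteq> (\<Union>k\<in>{n..<n+m}. snd (G k))" using f by fastforce
      then have "(\<Sum>e\<in>X. ennreal (edge_length d e)) \<le> graph_length d ({}, \<Union>k\<in>{n..<n+m}. snd (G k))"
        using X(1) by (intro sum_le_graph_length) auto
      also note part
      also have "ennreal (2 * (1/2) ^ n - 2 * (1/2) ^ (n + m)) \<le> ennreal (2 * (1/2) ^ n)"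
        by (intro ennreal_leI) simp
      finally show "(\<Sum>e\<in>X. ennreal (edge_length d e)) \<le> ennreal (2 * (1/2) ^ n)" .
    qed
  qed
  have GH_conn: "graph_connected (H n) C" if "n \<le> k" "C \<in> graph_components (G k)" for n k C
  proof (rule graph_connected_mono[OF graph_components_connected[OF that(2)]])
    show "C \<subseteq> fst (H n)" using graph_components_subset[OF that(2)] GH(1)[OF that(1)] by blast
  qed (use GH(2)[OF that(1)] in blast)
  define joined where "joined n v w \<longleftrightarrow> (\<exists>C. graph_connected (H n) C \<and> v \<in> C \<and> w \<in> C)" for n v w
  have joined_trans: "joined n u w" if uv: "joined n u v" and vw: "joined n v w" for n u v w
  proof -
    obtain C D where "graph_connected (H n) C" "u \<in> C" "v \<in> C"
        "graph_connected (H n) D" "v \<in> D" "w \<in> D"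
      using uv vw unfolding joined_def by blast
    moreover from this have "graph_connected (H n) (C \<union> D)" by (intro graph_connected_Un) auto
    ultimately show ?thesis unfolding joined_def by blast
  qed
  have joined_refl: "joined n v v" if "v \<in> fst (H n)" for n v
    unfolding joined_def using graph_connected_singleton[OF that] by blast
  have in_G: "\<exists>C\<in>graph_components (G k). v \<in> C" if "v \<in> fst (G k)" for k v
    using that G'(2)[of k] by (auto simp: spanned_by_def)
  \<comment> \<open>from a later graph back to \<open>F n\<close>: each component met on the way touches the finite set
    shared with the preceding graph\<close>
  have down: "\<exists>f\<in>F n. joined n v f" if "v \<in> fst (G (n + m))" for n m v
    using that
  proof (induction m arbitrary: v)
    case 0
    then obtain C where C: "C \<in> graph_components (G n)" "v \<in> C" using in_G[of v n] by auto
    then obtain f where "f \<in> F n" "f \<in> C" using G'(4)[OF C(1)] by blast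
    with C GH_conn[OF order_refl C(1)] show ?case unfolding joined_def by blast
  next
    case (Suc m)
    then obtain C where C: "C \<in> graph_components (G (n + Suc m))" "v \<in> C" using in_G by blast
    then obtain f where f: "f \<in> F (n + Suc m)" "f \<in> C" using G'(4)[OF C(1)] by blast
    have "f \<in> fst (G (n + m))" using G'(3)[of "n + m"] f(1) by auto
    then obtain g where g: "g \<in> F n" "joined n f g" using Suc.IH by blast
    have "joined n v f" unfolding joined_def using GH_conn[OF _ C(1), of n] C(2) f(2) by auto
    then show ?case using g joined_trans by blast
  qed
  define \<C> where "\<C> n = component_of (H n) ` F n" for n
  have FH: "F n \<subseteq> fst (H n)" for n using FG[of n] GH(1)[of n n] by blast
  have span: "spanned_by (H n) (\<C> n)" for n
  proof -
    have "v \<in> \<Union>(\<C> n)" if v: "v \<in> fst (H n)" for v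
    proof -
      obtain k where "n \<le> k" "v \<in> fst (G k)" using v by (auto simp: H_def)
      then obtain f where "f \<in> F n" "joined n v f" using down[of v n "k - n"] by auto
      then show ?thesis unfolding joined_def \<C>_def using subset_component_of[of "H n" _ f] by blast
    qed
    moreover have "C \<subseteq> fst (H n)" if "C \<in> \<C> n" for C
      using that graph_connected_component_of[of "H n"] by (auto simp: \<C>_def graph_connected_iff)
    ultimately have "\<Union>(\<C> n) = fst (H n)" by blast
    moreover have "C \<noteq> {} \<and> graph_connected (H n) C" if C: "C \<in> \<C> n" for C
    proof -
      obtain f where f: "f \<in> F n" "C = component_of (H n) f" using C by (auto simp: \<C>_def)
      then have "f \<in> C" using in_component_of[of f "H n"] FH[of n] by auto
      then show ?thesis using f(2) graph_connected_component_of[of "H n" f] by auto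
    qed
    ultimately show ?thesis using Ffin by (simp add: spanned_by_def \<C>_def)
  qed
  define A where "A = (\<Inter>n. cl (fst (H n)))"
  have reaches_A: "\<exists>x\<in>A. x \<in> cl (component_of (H n) f)" if f: "f \<in> F n" for n f
  proof -
    define nx where "nx k x = (SOME y. y \<in> F (Suc k) \<and> (\<exists>C\<in>graph_components (G k). x \<in> C \<and> y \<in> C))"
      for k x
    have nx: "nx k x \<in> F (Suc k) \<and> (\<exists>C\<in>graph_components (G k). x \<in> C \<and> nx k x \<in> C)"
      if x: "x \<in> F k" for k x
      unfolding nx_def
    proof (rule someI_ex)
      obtain C where C: "C \<in> graph_components (G k)" "x \<in> C" using in_G FG x by blast
      then show "\<exists>y. y \<in> F (Suc k) \<and> (\<exists>C\<in>graph_components (G k). x \<in> C \<and> y \<in> C)"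
        using G'(4)[OF C(1)] by blast
    qed
    define s where "s = rec_nat f (\<lambda>j. nx (n + j))"
    have s0: "s 0 = f" and s_Suc: "s (Suc j) = nx (n + j) (s j)" for j by (simp_all add: s_def)
    have sF: "s j \<in> F (n + j)" for j
      by (induction j) (use f nx in \<open>auto simp: s0 s_Suc\<close>)
    have s_in_H: "s j \<in> fst (H k)" if "k \<le> n + j" for j k
      using sF[of j] FG[of "n + j"] GH(1)[OF that] by blast
    have s_joined: "joined (n + i) (s i) (s (i + j))" for i j
    proof (induction j)
      case 0
      show ?case using joined_refl s_in_H by simp
    next
      case (Suc j)
      obtain C where "C \<in> graph_components (G (n + (i + j)))" "s (i + j) \<in> C" "s (Suc (i + j)) \<in> C"
        using nx[OF sF[of "i + j"]] s_Suc[of "i + j"] by auto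
      then have "joined (n + i) (s (i + j)) (s (i + Suc j))"
        using GH_conn[of "n + i" "n + (i + j)" C] unfolding joined_def by auto
      with Suc.IH show ?case by (rule joined_trans)
    qed
    \<comment> \<open>\<open>s i\<close> and all later points lie in one component of the short tail \<open>H (n + i)\<close>\<close>
    have s_dist: "d (s i) (s j) \<le> 2 * (1/2) ^ (n + i)" if ij: "i \<le> j" for i j
    proof -
      obtain C where C: "graph_connected (H (n + i)) C" "s i \<in> C" "s j \<in> C"
        using s_joined[of i "j - i"] ij unfolding joined_def by auto
      show ?thesis
        by (rule graph_connected_distance_le[OF H H_len _ C]) simp
    qed
    have "MCauchy s"
      unfolding MCauchy_def
    proof (intro conjI allI impI)
      show "range s \<subseteq> M" using s_in_H[of 0] H_sub[of 0] by auto
      fix e :: real assume "e > 0"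
      then obtain N where "(1/2) ^ N < e / 2" using real_arch_pow_inv[of "e/2" "1/2"] by auto
      then have N: "2 * (1/2) ^ N < e" by simp
      have *: "d (s i) (s j) < e" if "N \<le> i" "i \<le> j" for i j
      proof -
        have "(1/2 :: real) ^ (n + i) \<le> (1/2) ^ N" using that by (intro power_decreasing) auto
        then show ?thesis using s_dist[OF that(2)] N by linarith
      qed
      show "\<exists>N. \<forall>i j. N \<le> i \<longrightarrow> N \<le> j \<longrightarrow> d (s i) (s j) < e"
      proof (intro exI allI impI)
        fix i j assume "N \<le> i" "N \<le> j"
        then show "d (s i) (s j) < e" using *[of i j] *[of j i] commute[of "s i" "s j"] by linarith
      qed
    qed
    then obtain x where "limitin mtopology s x sequentially"
      using \<open>mcomplete\<close> by (auto simp: mcomplete_def)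
    then have x: "x \<in> M" "\<And>e. e > 0 \<Longrightarrow> \<exists>N. \<forall>j\<ge>N. s j \<in> M \<and> d (s j) x < e"
      by (auto simp: limit_metric_sequentially)
    have lim_cl: "x \<in> cl S" if S: "\<And>j. m \<le> j \<Longrightarrow> s j \<in> S" for S m
      unfolding in_cl_iff
    proof (intro conjI allI impI x(1))
      fix e :: real assume "e > 0"
      then obtain N where N: "\<forall>j\<ge>N. s j \<in> M \<and> d (s j) x < e" using x(2) by blast
      then have "s (max N m) \<in> M \<and> d x (s (max N m)) < e" by (simp add: commute[of x])
      then show "\<exists>y\<in>S. y \<in> M \<and> d x y < e" using S[of "max N m"] by auto
    qed
    have "x \<in> cl (fst (H m))" for m using s_in_H[of m] by (intro lim_cl[of m]) auto
    then have "x \<in> A" by (simp add: A_def)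
    moreover have "s j \<in> component_of (H n) f" for j
      using s_joined[of 0 j] subset_component_of[of "H n" _ f] unfolding joined_def s0 by auto
    then have "x \<in> cl (component_of (H n) f)" by (intro lim_cl[of 0]) auto
    ultimately show ?thesis by blast
  qed
  have A_cl: "A \<subseteq> cl (fst (H n))" for n by (auto simp: A_def)
  have touch: "F n \<inter> cl C \<noteq> {} \<and> A \<inter> cl C \<noteq> {}" if C: "C \<in> \<C> n" for n C
  proof -
    obtain f where f: "f \<in> F n" "C = component_of (H n) f" using C by (auto simp: \<C>_def)
    then have "f \<in> C" using in_component_of[of f "H n"] FH[of n] by auto
    moreover have "C \<subseteq> M" using span[of n] C H_sub[of n] by (auto simp: spanned_by_def)
    ultimately show ?thesis using f reaches_A[OF f(1)] subset_cl[of C] by blast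
  qed
  have link: "H n \<in> graphs_linking M d (F n) A" for n
  proof (rule graphs_linkingI[OF H span Fne _ touch])
    show "F n \<union> A \<subseteq> cl (fst (H n))" using FH[of n] subset_cl[OF H_sub[of n]] A_cl[of n] by blast
  qed
  have small: "\<exists>n. 2 * (1/2) ^ n < e" if "e > 0" for e :: real
    using real_arch_pow_inv[of "e/2" "1/2"] that by (auto simp: field_simps)
  have "A \<in> ZX M d"
  proof -
    have "A \<noteq> {}" using Fne[of 0] reaches_A[of _ 0] by blast
    moreover have "compactin mtopology A"
    proof -
      have "A \<subseteq> M" using A_cl[of 0] by (auto simp: in_cl_iff)
      have closed: "closedin mtopology A"
        unfolding A_def by (intro closedin_Inter) auto
      \<comment> \<open>one point of \<open>A\<close> near each component of a short tail forms a finite net inside \<open>A\<close>\<close>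
      have "mtotally_bounded A"
        unfolding mtotally_bounded_def
      proof (intro allI impI)
        fix e :: real assume "e > 0"
        then obtain n where n: "2 * (1/2) ^ n < e" using small by blast
        obtain p where p: "\<And>f. f \<in> F n \<Longrightarrow> p f \<in> A \<and> p f \<in> cl (component_of (H n) f)"
          using reaches_A[of _ n] by metis
        have "\<exists>f\<in>F n. a \<in> mball (p f) e" if a: "a \<in> A" for a
        proof -
          obtain f where f: "f \<in> F n" "a \<in> cl (component_of (H n) f)"
            using spanned_by_cl[OF span, of a n] A_cl[of n] a by (auto simp: \<C>_def)
          have "d (p f) a \<le> 2 * (1/2) ^ n"
            using p[OF f(1)] f(2)
            by (intro graph_connected_distance_cl_le[OF H H_len _ graph_connected_component_of]) auto
          then show ?thesis using n p[OF f(1)] f(1) a \<open>A \<subseteq> M\<close> by (intro bexI[of _ f]) auto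
        qed
        then show "\<exists>K. finite K \<and> K \<subseteq> A \<and> A \<subseteq> (\<Union>x\<in>K. mball x e)"
          using p Ffin[of n] by (intro exI[of _ "p ` F n"]) auto
      qed
      then have "compactin mtopology (cl A)"
        using \<open>mcomplete\<close> by (simp add: mtotally_bounded_eq_compact_closure_of)
      then show ?thesis using closed by (simp add: closure_of_closedin)
    qed
    moreover have "zero_length M d A"
      unfolding zero_length_def
    proof (intro allI impI)
      fix e :: real assume "e > 0"
      then obtain n where n: "2 * (1/2) ^ n < e" using small by blast
      have "H n \<in> graphs_covering M d A"
        using link[of n] by (auto simp: graphs_linking_def graphs_covering_def)
      moreover have "graph_length d (H n) < ennreal e"
        using H_len[of n] n by (meson ennreal_lessI le_less_trans \<open>e > 0\<close>)
      ultimately show "\<exists>\<Gamma>\<in>graphs_covering M d A. graph_length d \<Gamma> < ennreal e" by blast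
    qed
    ultimately show ?thesis by (simp add: ZX_def KX_def)
  qed
  moreover have "d1ZX M d (F n) A \<le> 2 * (1/2) ^ n" for n
    by (rule d1ZX_le[OF link H_len]) simp
  ultimately show ?thesis by blast
qed

text \<open>
  A fast subsequence of a Cauchy sequence is replaced by nearby finite sets, to which the
  preceding construction of a limit applies.
\<close>

theorem mcomplete_d1ZX:
  assumes "mcomplete"
  shows "Metric_space.mcomplete (ZX M d) (d1ZX M d)"
proof -
  interpret Z: Metric_space "ZX M d" "d1ZX M d" by (rule Metric_space_d1ZX)
  show ?thesis
    unfolding Z.mcomplete_def
  proof (intro allI impI)
    fix \<sigma> assume \<sigma>: "Z.MCauchy \<sigma>"
    then have \<sigma>Z: "\<sigma> n \<in> ZX M d" for n by (auto simp: Z.MCauchy_def)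
    have "\<exists>N. \<forall>m n. N \<le> m \<longrightarrow> N \<le> n \<longrightarrow> d1ZX M d (\<sigma> m) (\<sigma> n) < (1/2) ^ k / 4" for k
      using \<sigma> unfolding Z.MCauchy_def
      by (metis zero_less_divide_iff zero_less_numeral zero_less_power zero_less_one)
    then obtain N where N: "\<And>k m n. N k \<le> m \<Longrightarrow> N k \<le> n \<Longrightarrow> d1ZX M d (\<sigma> m) (\<sigma> n) < (1/2) ^ k / 4"
      by metis
    \<comment> \<open>strictly increasing because of the summand \<open>k\<close>, and above \<open>N k\<close> because of the sum\<close>
    define r where "r k = k + (\<Sum>i\<le>k. N i)" for k
    have r: "strict_mono r" by (rule strict_mono_Suc_iff[THEN iffD2]) (simp add: r_def)
    have rN: "N k \<le> r k" for k
      unfolding r_def using member_le_sum[of k "{..k}" N] by simp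
    have "\<exists>A\<in>FX M. d1ZX M d (\<sigma> (r k)) A < (1/2) ^ k / 4" for k
      using \<sigma>Z by (intro finite_set_near_ZX) auto
    then obtain F where F: "\<And>k. F k \<in> FX M" "\<And>k. d1ZX M d (\<sigma> (r k)) (F k) < (1/2) ^ k / 4"
      by metis
    have FZ: "F k \<in> ZX M d" for k using F(1) FX_subset_ZX by blast
    have "d1ZX M d (F k) (F (Suc k)) < (1/2) ^ k" for k
    proof -
      have "N k \<le> r (Suc k)" using rN[of k] strict_monoD[OF r, of k "Suc k"] by simp
      then have "d1ZX M d (\<sigma> (r k)) (\<sigma> (r (Suc k))) < (1/2) ^ k / 4" using N rN by blast
      moreover have "d1ZX M d (F k) (F (Suc k)) \<le> d1ZX M d (F k) (\<sigma> (r k)) + d1ZX M d (\<sigma> (r k)) (F (Suc k))"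
        "d1ZX M d (\<sigma> (r k)) (F (Suc k))
          \<le> d1ZX M d (\<sigma> (r k)) (\<sigma> (r (Suc k))) + d1ZX M d (\<sigma> (r (Suc k))) (F (Suc k))"
        using FZ \<sigma>Z by (auto intro: Z.triangle)
      moreover have "(0::real) < (1/2) ^ k" "(1/2 :: real) ^ Suc k = (1/2) ^ k / 2" by simp_all
      ultimately show ?thesis
        using F(2)[of k] F(2)[of "Suc k"] Z.commute[of "F k" "\<sigma> (r k)"] by linarith
    qed
    then obtain A where A: "A \<in> ZX M d" "\<And>k. d1ZX M d (F k) A \<le> 2 * (1/2) ^ k"
      using limit_of_joined_finite_sets[of F, OF assms F(1)] by blast
    have bound: "d1ZX M d (\<sigma> (r k)) A \<le> 3 * (1/2) ^ k" for k
    proof -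
      have "d1ZX M d (\<sigma> (r k)) A \<le> d1ZX M d (\<sigma> (r k)) (F k) + d1ZX M d (F k) A"
        using \<sigma>Z FZ A by (intro Z.triangle)
      moreover have "(0::real) < (1/2) ^ k" by simp
      ultimately show ?thesis using F(2)[of k] A(2)[of k] by linarith
    qed
    have "(\<lambda>k. d1ZX M d ((\<sigma> \<circ> r) k) A) \<longlonglongrightarrow> 0"
    proof (rule tendsto_sandwich)
      show "(\<lambda>k. 0 :: real) \<longlonglongrightarrow> 0" by (rule tendsto_const)
      show "(\<lambda>k. 3 * (1/2 :: real) ^ k) \<longlonglongrightarrow> 0"
        by (intro tendsto_mult_right_zero LIMSEQ_realpow_zero) auto
    qed (use bound in auto)
    then have "limitin Z.mtopology (\<sigma> \<circ> r) A sequentially"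
      using A(1) \<sigma>Z by (simp add: Z.limitin_metric_dist_null)
    then show "\<exists>A. limitin Z.mtopology \<sigma> A sequentially"
      using Z.MCauchy_convergent_subsequence[OF \<sigma> r] by blast
  qed
qed

section \<open>Dense subspaces\<close>

lemma dense_subsetE:
  assumes "dense_subset M d Y" "x \<in> M" "e > 0"
  shows "\<exists>y\<in>Y. d x y < e"
  using assms in_cl_iff[of x Y] by (auto simp: dense_subset_def)

lemma closure_of_subspace:
  assumes "Y \<subseteq> M" "S \<subseteq> Y"
  shows "Metric_space.mtopology Y d closure_of S = Y \<inter> cl S"
proof -
  interpret Y: Metric_space Y d using subspace[OF assms(1)] .
  show ?thesis using assms by (auto simp: Y.in_cl_iff in_cl_iff; blast)
qed

lemma graphs_linking_subspace:
  assumes "Y \<subseteq> M"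
  shows "graphs_linking Y d A B \<subseteq> graphs_linking M d A B"
proof
  fix \<Gamma> assume \<Gamma>: "\<Gamma> \<in> graphs_linking Y d A B"
  then have V: "fst \<Gamma> \<subseteq> Y" by (auto simp: graphs_linking_def graph_in_def)
  have "C \<subseteq> Y" if "C \<in> graph_components \<Gamma>" for C
    using graph_components_subset[OF that] V by blast
  then show "\<Gamma> \<in> graphs_linking M d A B"
    using \<Gamma> assms by (auto simp: graphs_linking_def graph_in_def closure_of_subspace[OF assms V]
      closure_of_subspace[OF assms]; blast)
qed

lemma ZX_subspace:
  assumes "Y \<subseteq> M"
  shows "ZX Y d \<subseteq> ZX M d"
proof
  interpret Y: Submetric M d Y by unfold_locales (rule assms)
  fix A assume "A \<in> ZX Y d"
  note A = Y.sub.ZX_D[OF this]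
  have "compactin mtopology A"
    using A(3) by (simp add: Y.mtopology_submetric compactin_subtopology)
  moreover have "graphs_covering Y d A \<subseteq> graphs_covering M d A"
  proof
    fix \<Gamma> assume \<Gamma>: "\<Gamma> \<in> graphs_covering Y d A"
    then have V: "fst \<Gamma> \<subseteq> Y" by (auto simp: graphs_covering_def graph_in_def)
    show "\<Gamma> \<in> graphs_covering M d A"
      using \<Gamma> assms by (auto simp: graphs_covering_def graph_in_def closure_of_subspace[OF assms V])
  qed
  then have "zero_length M d A" using A(4) by (auto simp: zero_length_def; blast)
  ultimately show "A \<in> ZX M d" using A(1) by (simp add: ZX_def KX_def)
qed

text \<open>
  The vertices of an infinite graph cannot simply be moved into \<open>Y\<close>, since even a slight move of
  a vertex of infinite degree may add an infinite length. For finite sets, finite trees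
  suffice, and their vertices can be moved into \<open>Y\<close> at small cost.
\<close>

lemma d1ZX_dense_finite_le:
  assumes Y: "dense_subset M d Y" and F: "F \<in> FX Y" and G: "G \<in> FX Y"
  shows "d1ZX Y d F G \<le> d1ZX M d F G"
proof (rule field_le_epsilon)
  fix e :: real assume "e > 0"
  have "Y \<subseteq> M" using Y by (simp add: dense_subset_def)
  interpret Y: Metric_space Y d using subspace[OF \<open>Y \<subseteq> M\<close>] .
  have F': "F \<noteq> {}" "finite F" "F \<subseteq> Y" and G': "finite G" "G \<subseteq> Y"
    using F G by (auto simp: FX_def)
  have FM: "F \<in> FX M" "G \<in> FX M" using F G \<open>Y \<subseteq> M\<close> by (auto simp: FX_def)
  define r where "r = d1ZX M d F G + e / 2"
  have "0 \<le> r" "d1ZX M d F G < r" using \<open>e > 0\<close> d1ZX_nonneg[of M F G] by (auto simp: r_def)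
  then obtain \<Gamma> where \<Gamma>: "\<Gamma> \<in> graphs_joining F G" "graph_length d \<Gamma> \<le> ennreal r"
    using d1ZX_less_joiningE[OF FM] by blast
  note \<Gamma>' = graphs_joiningD[OF \<Gamma>(1) F'(1)]
  obtain V T where VT: "\<And>C. C \<in> graph_components \<Gamma> \<Longrightarrow>
    grown_tree (V C) (T C) \<and> (F \<union> G) \<inter> C \<subseteq> V C \<and> V C \<subseteq> C \<and> T C \<subseteq> snd \<Gamma>"
    using component_trees[OF \<Gamma>(1) F'(1,2) G'(1)] by blast
  define E where "E = (\<Union>C\<in>graph_components \<Gamma>. T C)"
  have fin: "finite (graph_components \<Gamma>)" and un: "\<Union>(graph_components \<Gamma>) = fst \<Gamma>"
    using \<Gamma>'(2) by (auto simp: spanned_by_def)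
  have "finite E" unfolding E_def using fin VT grown_tree_basic(3) by blast
  have "E \<subseteq> snd \<Gamma>" unfolding E_def using VT by blast
  have VM: "fst \<Gamma> \<subseteq> M" using \<Gamma>'(1) by (simp add: graph_in_iff)
  have E_vertices: "\<exists>x y. e = {x, y} \<and> x \<in> M \<and> y \<in> M \<and> x \<in> (\<Union>C\<in>graph_components \<Gamma>. V C)
      \<and> y \<in> (\<Union>C\<in>graph_components \<Gamma>. V C)" if e: "e \<in> E" for e
  proof -
    have "e \<in> snd \<Gamma>" using e \<open>E \<subseteq> snd \<Gamma>\<close> by blast
    then have "\<exists>x\<in>fst \<Gamma>. \<exists>y\<in>fst \<Gamma>. e = {x, y}" using \<Gamma>'(1) by (simp add: graph_in_iff)
    then obtain x y where xy: "e = {x, y}" "x \<in> M" "y \<in> M" using VM by blast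
    obtain C where C: "C \<in> graph_components \<Gamma>" "e \<in> T C" using e by (auto simp: E_def)
    then have "e \<subseteq> V C" using VT[OF C(1)] grown_tree_basic(4)[of "V C" "T C"] by blast
    then show ?thesis using xy C(1) by auto
  qed
  then obtain a b where ab: "\<And>e. e \<in> E \<Longrightarrow> e = {a e, b e} \<and> a e \<in> M \<and> b e \<in> M
      \<and> a e \<in> (\<Union>C\<in>graph_components \<Gamma>. V C) \<and> b e \<in> (\<Union>C\<in>graph_components \<Gamma>. V C)"
    by metis
  define \<delta> where "\<delta> = e / 4 / (real (card E) + 1)"
  have "\<delta> > 0" using \<open>e > 0\<close> by (simp add: \<delta>_def add_nonneg_pos)
  have "\<exists>y. x \<in> M \<longrightarrow> y \<in> Y \<and> d x y < \<delta> \<and> (x \<in> Y \<longrightarrow> y = x)" for x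
    using dense_subsetE[OF Y _ \<open>\<delta> > 0\<close>, of x] \<open>\<delta> > 0\<close> by (cases "x \<in> Y") auto
  then obtain h where h: "\<And>x. x \<in> M \<Longrightarrow> h x \<in> Y \<and> d x (h x) < \<delta> \<and> (x \<in> Y \<longrightarrow> h x = x)"
    by metis
  \<comment> \<open>the perturbation must not move the two sets that are to be joined\<close>
  have h_fix: "h x = x" if "x \<in> F \<union> G" for x using that h[of x] F' G' \<open>Y \<subseteq> M\<close> by blast
  have VCM: "V C \<subseteq> M" if "C \<in> graph_components \<Gamma>" for C
    using VT[OF that] graph_components_subset[OF that] VM by blast
  define \<Delta> where "\<Delta> = (h ` (\<Union>C\<in>graph_components \<Gamma>. V C), (\<lambda>e. {h (a e), h (b e)}) ` E)"
  have image_E: "snd \<Delta> = (\<lambda>e. h ` e) ` E"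
    unfolding \<Delta>_def snd_conv
  proof (rule image_cong[OF refl])
    fix e assume "e \<in> E"
    then have "e = {a e, b e}" using ab by blast
    then show "{h (a e), h (b e)} = h ` e" by (metis image_empty image_insert)
  qed
  have "\<Delta> \<in> Y.graphs_joining F G"
  proof (rule Y.graphs_joiningI[of _ "(\<lambda>C. h ` V C) ` graph_components \<Gamma>"])
    show "graph_in Y \<Delta>"
      unfolding graph_in_iff
    proof (intro conjI ballI)
      show "fst \<Delta> \<subseteq> Y" using h VCM by (fastforce simp: \<Delta>_def)
      fix e' assume "e' \<in> snd \<Delta>"
      then obtain e where "e \<in> E" "e' = {h (a e), h (b e)}" by (auto simp: \<Delta>_def)
      moreover from this have "h (a e) \<in> fst \<Delta>" "h (b e) \<in> fst \<Delta>" using ab[of e] by (auto simp: \<Delta>_def)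
      ultimately show "\<exists>x\<in>fst \<Delta>. \<exists>y\<in>fst \<Delta>. e' = {x, y}" by blast
    qed
    have "graph_connected \<Delta> (h ` V C) \<and> h ` V C \<noteq> {}" if C: "C \<in> graph_components \<Gamma>" for C
    proof -
      have "grown_tree (V C) (T C)" using VT[OF C] by blast
      then have conn: "graph_connected (h ` V C, (\<lambda>e. h ` e) ` T C) (h ` V C)" and "V C \<noteq> {}"
        using graph_connected_image[OF grown_tree_connected] grown_tree_basic(2) by blast+
      have "h ` V C \<subseteq> fst \<Delta>" using C by (auto simp: \<Delta>_def)
      moreover have "(\<lambda>e. h ` e) ` T C \<subseteq> snd \<Delta>" unfolding image_E using C by (auto simp: E_def)
      then have "e \<in> snd \<Delta>" if "e \<in> snd (h ` V C, (\<lambda>e. h ` e) ` T C)" for e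
        using that by (simp add: subset_iff)
      ultimately have "graph_connected \<Delta> (h ` V C)" by (rule graph_connected_mono[OF conn])
      then show ?thesis using \<open>V C \<noteq> {}\<close> by simp
    qed
    then show "spanned_by \<Delta> ((\<lambda>C. h ` V C) ` graph_components \<Gamma>)"
      using fin by (auto simp: spanned_by_def \<Delta>_def)
    show "F \<union> G \<subseteq> fst \<Delta>"
    proof
      fix x assume x: "x \<in> F \<union> G"
      then obtain C where C: "C \<in> graph_components \<Gamma>" "x \<in> C" using \<Gamma>'(3) un by blast
      then have "x \<in> V C" using VT[OF C(1)] x by blast
      then have "h x \<in> fst \<Delta>" using C(1) by (auto simp: \<Delta>_def)
      then show "x \<in> fst \<Delta>" using h_fix[OF x] by simp
    qed
    fix D assume "D \<in> (\<lambda>C. h ` V C) ` graph_components \<Gamma>"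
    then obtain C where C: "C \<in> graph_components \<Gamma>" "D = h ` V C" by blast
    have "x \<in> D" if "x \<in> F \<union> G" "x \<in> C" for x
      using that VT[OF C(1)] h_fix[OF that(1)] C(2) by (metis IntI imageI subsetD)
    then show "F \<inter> D \<noteq> {} \<and> G \<inter> D \<noteq> {}" using \<Gamma>'(4)[OF C(1)] by blast
  qed (rule F'(1))
  then have link: "\<Delta> \<in> graphs_linking Y d F G" using F'(1) by (rule Y.graphs_joining_linking)
  have "graph_length d \<Delta> \<le> ennreal (\<Sum>e\<in>E. d (h (a e)) (h (b e)))"
    unfolding \<Delta>_def by (rule graph_length_added_edges[OF \<open>finite E\<close>])
  also have "(\<Sum>e\<in>E. d (h (a e)) (h (b e))) \<le> (\<Sum>e\<in>E. edge_length d e + 2 * \<delta>)"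
  proof (rule sum_mono)
    fix e assume e: "e \<in> E"
    have M: "a e \<in> M" "b e \<in> M" "h (a e) \<in> M" "h (b e) \<in> M" using ab[OF e] h \<open>Y \<subseteq> M\<close> by auto
    have "d (h (a e)) (h (b e)) \<le> d (h (a e)) (a e) + d (a e) (h (b e))"
      "d (a e) (h (b e)) \<le> d (a e) (b e) + d (b e) (h (b e))"
      using M by (auto intro: triangle)
    moreover have "edge_length d e = d (a e) (b e)" using ab[OF e] edge_length_pair by metis
    ultimately show "d (h (a e)) (h (b e)) \<le> edge_length d e + 2 * \<delta>"
      using h[OF M(1)] h[OF M(2)] commute[of "h (a e)" "a e"] by linarith
  qed
  also have "\<dots> \<le> r + e / 2"
  proof -
    have "(\<Sum>e\<in>E. edge_length d e) \<le> r"
      using sum_edge_length_le[OF \<Gamma>'(1) \<Gamma>(2) \<open>0 \<le> r\<close> \<open>finite E\<close> \<open>E \<subseteq> snd \<Gamma>\<close>] .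
    moreover have "real (card E) * (2 * \<delta>) \<le> e / 2"
      using \<open>e > 0\<close> by (simp add: \<delta>_def field_simps)
    ultimately show ?thesis by (simp add: sum.distrib)
  qed
  finally have "graph_length d \<Delta> \<le> ennreal (r + e / 2)" by (simp add: ennreal_leI)
  then have "d1ZX Y d F G \<le> r + e / 2"
    using \<open>0 \<le> r\<close> \<open>e > 0\<close> by (intro Y.d1ZX_le[OF link]) auto
  then show "d1ZX Y d F G \<le> d1ZX M d F G + e" by (simp add: r_def)
qed

text \<open>
  A graph in the subspace is a graph in the whole space, which gives one inequality. The other
  one holds for finite sets, and finite sets are dense already with respect to the larger of
  the two distances.
\<close>

theorem d1ZX_dense_subspace:
  assumes Y: "dense_subset M d Y" and A: "A \<in> ZX Y d" and B: "B \<in> ZX Y d"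
  shows "d1ZX Y d A B = d1ZX M d A B"
proof -
  have "Y \<subseteq> M" using Y by (simp add: dense_subset_def)
  interpret Y: Metric_space Y d using subspace[OF \<open>Y \<subseteq> M\<close>] .
  interpret Z: Metric_space "ZX M d" "d1ZX M d" by (rule Metric_space_d1ZX)
  interpret YZ: Metric_space "ZX Y d" "d1ZX Y d" by (rule Y.Metric_space_d1ZX)
  have le: "d1ZX M d A B \<le> d1ZX Y d A B" if A: "A \<in> ZX Y d" and B: "B \<in> ZX Y d" for A B
  proof (rule field_le_epsilon)
    fix e :: real assume "e > 0"
    then have less: "d1ZX Y d A B < d1ZX Y d A B + e" by simp
    obtain \<Gamma> where \<Gamma>: "\<Gamma> \<in> graphs_linking Y d A B" "graph_length d \<Gamma> \<le> ennreal (d1ZX Y d A B + e)"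
      using Y.d1ZX_lessE[OF A B less] .
    then show "d1ZX M d A B \<le> d1ZX Y d A B + e"
      using graphs_linking_subspace[OF \<open>Y \<subseteq> M\<close>] \<open>e > 0\<close> d1ZX_nonneg[of Y A B] by (intro d1ZX_le) auto
  qed
  have "d1ZX Y d A B \<le> d1ZX M d A B"
  proof (rule field_le_epsilon)
    fix e :: real assume "e > 0"
    then obtain F G where F: "F \<in> FX Y" "d1ZX Y d A F < e / 4" and G: "G \<in> FX Y" "d1ZX Y d B G < e / 4"
      using Y.finite_set_near_ZX[OF A, of "e/4"] Y.finite_set_near_ZX[OF B, of "e/4"] by auto
    have FG: "F \<in> ZX Y d" "G \<in> ZX Y d" using F G Y.FX_subset_ZX by auto
    have sub: "A \<in> ZX M d" "B \<in> ZX M d" "F \<in> ZX M d" "G \<in> ZX M d"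
      using A B FG ZX_subspace[OF \<open>Y \<subseteq> M\<close>] by auto
    have "d1ZX Y d A B \<le> d1ZX Y d A F + d1ZX Y d F B" "d1ZX Y d F B \<le> d1ZX Y d F G + d1ZX Y d G B"
      using A B FG by (auto intro: YZ.triangle)
    moreover have "d1ZX Y d F G \<le> d1ZX M d F G" by (rule d1ZX_dense_finite_le[OF Y F(1) G(1)])
    moreover have "d1ZX M d F G \<le> d1ZX M d F A + d1ZX M d A G" "d1ZX M d A G \<le> d1ZX M d A B + d1ZX M d B G"
      using sub by (auto intro: Z.triangle)
    moreover have "d1ZX M d F A \<le> d1ZX Y d A F" "d1ZX M d B G \<le> d1ZX Y d B G"
      using le[OF A FG(1)] le[OF B FG(2)] Z.commute[of F A] by simp_all
    ultimately show "d1ZX Y d A B \<le> d1ZX M d A B + e"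
      using F(2) G(2) YZ.commute[of G B] by linarith
  qed
  with le[OF A B] show ?thesis by (rule antisym[rotated])
qed

text \<open>
  Moving the points of a finite set one by one into \<open>Y\<close> costs at most the sum of the
  displacements.
\<close>

lemma dense_subset_FX_dense:
  assumes Y: "dense_subset M d Y"
  shows "dense_subset (ZX M d) (d1ZX M d) (FX Y)"
proof -
  interpret Z: Metric_space "ZX M d" "d1ZX M d" by (rule Metric_space_d1ZX)
  have "Y \<subseteq> M" using Y by (simp add: dense_subset_def)
  then have "FX Y \<subseteq> FX M" by (auto simp: FX_def)
  then have sub: "FX Y \<subseteq> ZX M d" using FX_subset_ZX by (rule subset_trans)
  have "\<exists>G\<in>FX Y. d1ZX M d A G < e" if A: "A \<in> ZX M d" and "e > 0" for A e
  proof -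
    obtain F where F: "F \<in> FX M" "d1ZX M d A F < e / 2"
      using finite_set_near_ZX[OF A, of "e/2"] \<open>e > 0\<close> by auto
    obtain xs where xs: "set xs = F" using F(1) finite_list by (auto simp: FX_def)
    have xsM: "xs \<noteq> []" "set xs \<subseteq> M" using xs F(1) by (auto simp: FX_def)
    define \<delta> where "\<delta> = e / 2 / (real (length xs) + 1)"
    have "\<delta> > 0" using \<open>e > 0\<close> by (simp add: \<delta>_def add_nonneg_pos)
    then have "\<forall>x\<in>M. \<exists>y. y \<in> Y \<and> d x y < \<delta>" using dense_subsetE[OF Y] by blast
    then obtain h where h: "\<And>x. x \<in> M \<Longrightarrow> h x \<in> Y \<and> d x (h x) < \<delta>" by metis
    have G: "set (map h xs) \<in> FX Y" using xsM h by (auto simp: FX_def)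
    have "d1ZX M d (set xs) (set (map h xs)) \<le> (\<Sum>i<length xs. d (xs ! i) (map h xs ! i))"
      using xsM h \<open>Y \<subseteq> M\<close>
      by (intro l1_nonexpanding_d1ZX[unfolded l1_nonexpanding_def, rule_format]) (auto simp: Suc_le_eq)
    also have "\<dots> \<le> (\<Sum>i<length xs. \<delta>)"
    proof (rule sum_mono)
      fix i assume "i \<in> {..<length xs}"
      then have "i < length xs" "xs ! i \<in> M" using xsM(2) nth_mem[of i xs] by auto
      then show "d (xs ! i) (map h xs ! i) \<le> \<delta>" using h[of "xs ! i"] by simp
    qed
    also have "\<dots> \<le> e / 2" using \<open>e > 0\<close> by (simp add: \<delta>_def field_simps)
    finally have "d1ZX M d F (set (map h xs)) \<le> e / 2" by (simp add: xs)
    moreover have "d1ZX M d A (set (map h xs)) \<le> d1ZX M d A F + d1ZX M d F (set (map h xs))"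
      using A F(1) G sub FX_subset_ZX by (intro Z.triangle) auto
    ultimately show ?thesis using F(2) G by (intro bexI[of _ "set (map h xs)"]) linarith+
  qed
  then have "ZX M d \<subseteq> Z.cl (FX Y)" using sub by (fastforce simp: Z.in_cl_iff)
  moreover have "Z.cl (FX Y) \<subseteq> ZX M d" by (auto simp: Z.in_cl_iff)
  ultimately show ?thesis using sub by (auto simp: dense_subset_def)
qed

end

text \<open>
  A completion carries its own distance function, which agrees with \<open>d\<close> on \<open>X\<close> only.
\<close>

lemma d1FX_cong:
  assumes "\<And>x y. x \<in> X \<Longrightarrow> y \<in> X \<Longrightarrow> d x y = d' x y"
  shows "d1FX X d = d1FX X d'"
proof -
  have sums: "(\<Sum>i<n. d (x ! i) (y ! i)) = (\<Sum>i<n. d' (x ! i) (y ! i))"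
    if "length x = n \<and> length y = n \<and> set x \<subseteq> X \<and> set y \<subseteq> X" for n x y
    using that by (intro sum.cong refl assms) (auto simp: subset_iff)
  have "l1_nonexpanding X d \<rho> = l1_nonexpanding X d' \<rho>" for \<rho>
    unfolding l1_nonexpanding_def by (simp add: sums cong: imp_cong)
  then show ?thesis by (simp add: d1FX_def is_largest_FX_metric_def)
qed

theorem is_completion_d1FX:
  assumes "is_completion X d X' d'"
  shows "is_completion (FX X) (d1FX X d) (ZX X' d') (d1ZX X' d')"
proof -
  have X: "Metric_space X d" "Metric_space.mcomplete X' d'" and dense: "dense_subset X' d' X"
    and eq: "\<And>x y. x \<in> X \<Longrightarrow> y \<in> X \<Longrightarrow> d x y = d' x y" and X': "Metric_space X' d'"
    using assms by (auto simp: is_completion_def)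
  interpret X': Metric_space X' d' by (rule X')
  have "X \<subseteq> X'" using dense by (simp add: dense_subset_def)
  interpret XX': Metric_space X d' using X'.subspace[OF \<open>X \<subseteq> X'\<close>] .
  have "d1ZX X' d' A B = d1FX X d A B" if AB: "A \<in> FX X" "B \<in> FX X" for A B
  proof -
    have "A \<in> ZX X d'" "B \<in> ZX X d'" using AB XX'.FX_subset_ZX by auto
    then show ?thesis
      using X'.d1ZX_dense_subspace[OF dense] XX'.d1ZX_eq_d1FX[OF AB] d1FX_cong[of X d d', OF eq] by simp
  qed
  moreover have "Metric_space (FX X) (d1FX X d)"
    using is_largest_FX_metric_d1FX[OF X(1)] by (simp add: is_largest_FX_metric_def)
  ultimately show ?thesis
    using X'.Metric_space_d1ZX X'.mcomplete_d1ZX[OF X(2)] X'.dense_subset_FX_dense[OF dense]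
    by (simp add: is_completion_def)
qed

theorem theorem1:
  fixes X :: "'a set" and d :: "'a \<Rightarrow> 'a \<Rightarrow> real"
  assumes "Metric_space X d"
  shows
    "((\<forall>A\<in>ZX X d. \<forall>B\<in>ZX X d. d1ZX_ennreal X d A B < \<infinity>) \<and> Metric_space (ZX X d) (d1ZX X d)) \<and>
     (\<forall>A\<in>ZX X d. \<forall>B\<in>ZX X d. dKX d A B \<le> d1ZX X d A B) \<and>
     (\<forall>A\<in>FX X. \<forall>B\<in>FX X. d1ZX X d A B = d1FX X d A B) \<and>
     dense_subset (ZX X d) (d1ZX X d) (FX X) \<and>
     (Metric_space.mcomplete X d \<longrightarrow> Metric_space.mcomplete (ZX X d) (d1ZX X d)) \<and>
     (\<forall>Y. dense_subset X d Y \<longrightarrow>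
        (\<forall>A\<in>ZX Y d. \<forall>B\<in>ZX Y d. d1ZX Y d A B = d1ZX X d A B)) \<and>
     (\<forall>X' d'. is_completion X d X' d' \<longrightarrow>
        is_completion (FX X) (d1FX X d) (ZX X' d') (d1ZX X' d'))"
proof -
  interpret Metric_space X d by fact
  show ?thesis
    using d1ZX_ennreal_finite Metric_space_d1ZX dKX_le_d1ZX d1ZX_eq_d1FX dense_subset_FX
      mcomplete_d1ZX d1ZX_dense_subspace is_completion_d1FX
    by (intro conjI ballI allI impI) assumption+
qed

end
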